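(* Let $n\ge1$, $t>0$ and $\mathbf{C}_n(t)=\{(x_1,\dots,x_n):1\le x_1\le 1+t,\ 1\le x_i\le(1+t)x_{i-1}\ (2\le i\le n)\}$. For a plane tree $T$ on $n+1$ nodes let $\mathbf{D}_T(t)\subset\mathbb{R}^n$ be defined by $$1\le \frac{x_{p(u_1)}}{(1+t)^{j(u_1)}}\le\dots\le\frac{x_{p(u_k)}}{(1+t)^{j(u_k)}}\le 1+t$$ for every node of $T$ with children $u_1,\dots,u_k$ (left to right), where $p(u)$ is the NFS position and $j(u)$ the number of cane paths starting at $u$. Then $\mathbf{D}_T(t)$ is a bounded polytope and $$n!\operatorname{vol}\mathbf{D}_T(t)=\sum_{G:\ \Psi(G)=T}t^{|E(G)|}=t^n(1+t)^{\binom{n+1}{2}-\sum_{i=1}^{n+1}i\,d_i}\binom{n}{d_1,d_2,\dots,d_{n+1}},$$ the sum over labeled graphs $G$ on $\{1,\dots,n+1\}$, where $(d_1,\dots,d_{n+1})$ is the degree sequence of $T$. Furthermore, the polytopes $\mathbf{D}_T(t)$, $T$ ranging over plane trees on $n+1$ nodes, form a subdivision of $\mathbf{C}_n(t)$; in particular $n!\operatorname{vol}\mathbf{C}_n(t)=\sum_G t^{|E(G)|}$, the sum over all connected labeled graphs $G$ on $\{1,\dots,n+1\}$.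
   Context: A plane tree is an unlabeled rooted tree with children of each node ordered left to right. Degree = number of children; the degree sequence lists degrees in depth-first (preorder) traversal: root, then subtrees of the children recursively left to right. NFS positions in a forest on $n+1$ nodes: components processed left to right; when a component is begun its root gets the next unused position (starting from $0$); within a component the root is initially active, the children of the active node receive the next consecutive positions from right to left and then the leftmost child becomes active; if the active node has no children, the most recently positioned node not yet active becomes active. Cane path: a path $v_0,\dots,v_k$ ($k\ge 2$) whose first $k-1$ steps go from a node to its parent and whose last step goes from $v_{k-1}$ to a child of $v_{k-1}$ to the right of $v_{k-2}$. Labeled forests on $\{1,\dots,n+1\}$ are viewed as plane forests by rooting components at the largest label, ordering children by increasing label and components by decreasing largest label. NFS of a labeled graph $G$: components are processed in order of decreasing maximal label; in a component, its node of maximal label is visited first and made active; at each step the unvisited neighbours of the active node are visited in decreasing order of label, each joined to the active node by a search edge, and the one of smallest label becomes active; if the active node has no unvisited neighbours, the most recently visited node not yet active becomes active. $\Psi(G)$ is the plane forest underlying the forest of search edges. A subdivision of a polytope $P$ is a finite set of full-dimensional polytopes with union $P$ and pairwise disjoint interiors. *)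

theory Defs
  imports "HOL-Analysis.Analysis"
begin

datatype plane_tree = Node (subtrees: "plane_tree list")

lemma size_enumerate_less [termination_simp]:
  "(i, s) \<in> set (List.enumerate k ts) \<Longrightarrow> size s < Suc (size_list size ts)"
  by (induction ts arbitrary: k) (auto, fastforce)

text \<open>
  Nodes are addressed by the sequence of child indices (from 0, left to right) leading to them
  from the root, so the root is \<open>[]\<close> and the parent of \<open>u @ [i]\<close> is \<open>u\<close>.
\<close>

fun preorder :: "plane_tree \<Rightarrow> nat list list" where
  "preorder (Node ts) = [] # concat (map (\<lambda>(i, s). map ((#) i) (preorder s)) (List.enumerate 0 ts))"

fun subtree_at :: "plane_tree \<Rightarrow> nat list \<Rightarrow> plane_tree" where
  "subtree_at T [] = T"
| "subtree_at T (i # u) = subtree_at (subtrees T ! i) u"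

definition degree_at :: "plane_tree \<Rightarrow> nat list \<Rightarrow> nat" where
  "degree_at T u = length (subtrees (subtree_at T u))"

definition children :: "plane_tree \<Rightarrow> nat list \<Rightarrow> nat list list" where
  "children T u = map (\<lambda>i. u @ [i]) [0..<degree_at T u]"

definition degree_seq :: "plane_tree \<Rightarrow> nat list" where
  "degree_seq T = map (degree_at T) (preorder T)"

definition plane_trees :: "nat \<Rightarrow> plane_tree set" where
  "plane_trees m = {T. length (preorder T) = m}"

text \<open>
  The argument is the list of positioned nodes that have not yet been active, most recently
  positioned first, each paired with the subtree below it; its head becomes active next. As
  children are positioned from right to left, the leftmost child of the active node is the most
  recently positioned one, so the two cases of the activation rule coincide.
\<close>

function nfs_visits :: "(nat list \<times> plane_tree) list \<Rightarrow> nat list list" where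
  "nfs_visits [] = []"
| "nfs_visits ((u, Node ts) # st) =
     (let cs = map (\<lambda>(i, s). (u @ [i], s)) (List.enumerate 0 ts)
      in map fst (rev cs) @ nfs_visits (cs @ st))"
  by pat_completeness auto
termination
proof (relation "Wellfounded.measure (\<lambda>st. sum_list (map (\<lambda>(u, s). size s) st))", goal_cases)
  case (2 u ts st cs)
  have "sum_list (map (\<lambda>(u, s). size s) (map (\<lambda>(i, s). (u @ [i], s)) (List.enumerate k ts)))
          = sum_list (map size ts)" for k
    by (induction ts arbitrary: k) auto
  then show ?case
    using 2 by (simp add: size_list_conv_sum_list)
qed simp

definition nfs_order :: "plane_tree \<Rightarrow> nat list list" where
  "nfs_order T = [] # nfs_visits [([], T)]"

definition nfs_pos :: "plane_tree \<Rightarrow> nat list \<Rightarrow> nat" where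
  "nfs_pos T u = (THE i. i < length (nfs_order T) \<and> nfs_order T ! i = u)"

definition cane_path :: "plane_tree \<Rightarrow> nat list list \<Rightarrow> bool" where
  "cane_path T v \<longleftrightarrow> (let k = length v - 1 in
     2 \<le> k \<and> set v \<subseteq> set (preorder T) \<and>
     (\<forall>m<k - 1. \<exists>i. v ! m = v ! Suc m @ [i]) \<and>
     (\<exists>i l. v ! (k - 2) = v ! (k - 1) @ [i] \<and> v ! k = v ! (k - 1) @ [l] \<and> i < l))"

definition cane_count :: "plane_tree \<Rightarrow> nat list \<Rightarrow> nat" where
  "cane_count T u = card {v. cane_path T v \<and> hd v = u}"

definition labeled_graphs :: "nat \<Rightarrow> nat set set set" where
  "labeled_graphs m = Pow {e. e \<subseteq> {1..m} \<and> card e = 2}"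

definition reach :: "nat set set \<Rightarrow> (nat \<times> nat) set" where
  "reach E = {(a, b). {a, b} \<in> E}\<^sup>*"

definition graph_connected :: "nat \<Rightarrow> nat set set \<Rightarrow> bool" where
  "graph_connected m E \<longleftrightarrow> (\<forall>a\<in>{1..m}. \<forall>b\<in>{1..m}. (a, b) \<in> reach E)"

definition components_of_graph :: "nat \<Rightarrow> nat set set \<Rightarrow> nat set set" where
  "components_of_graph m E = (\<lambda>a. reach E `` {a}) ` {1..m}"

text \<open>The maximal labels of the components, in decreasing order.\<close>

definition component_roots :: "nat \<Rightarrow> nat set set \<Rightarrow> nat list" where
  "component_roots m E = rev (sorted_list_of_set (Max ` components_of_graph m E))"

text \<open>
  Lists the search edges found within one component. The first list holds the unvisited nodes in
  decreasing order; the second the visited nodes that have not yet been active, most recently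
  visited first, whose head becomes active next. The neighbour of smallest label is visited last,
  so again the two cases of the activation rule coincide.
\<close>

function nfs_search :: "nat set set \<Rightarrow> nat list \<Rightarrow> nat list \<Rightarrow> nat set list" where
  "nfs_search E us [] = []"
| "nfs_search E us (a # st) =
     (let new = filter (\<lambda>u. {a, u} \<in> E) us
      in map (\<lambda>u. {a, u}) new @
         nfs_search E (filter (\<lambda>u. {a, u} \<notin> E) us) (rev new @ st))"
  by pat_completeness auto
termination
proof (relation "Wellfounded.measure (\<lambda>(E, us, st). 2 * length us + length st)", goal_cases)
  case (2 E us a st new)
  then show ?case
    using sum_length_filter_compl[of "\<lambda>u. {a, u} \<in> E" us] by simp
qed simp

definition nfs_edges :: "nat \<Rightarrow> nat set set \<Rightarrow> nat set set" where
  "nfs_edges m E = set (concat (map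
     (\<lambda>r. nfs_search E (rev (sorted_list_of_set (reach E `` {r} - {r}))) [r])
     (component_roots m E)))"

text \<open>
  The plane tree of the descendants of \<open>v\<close> in a labeled forest \<open>F\<close>, where \<open>us\<close> lists in
  increasing order the nodes of the component other than \<open>v\<close> and its ancestors. In a forest the
  neighbours of \<open>v\<close> in \<open>us\<close> are precisely its children.
\<close>

function plane_tree_at :: "nat set set \<Rightarrow> nat list \<Rightarrow> nat \<Rightarrow> plane_tree" where
  "plane_tree_at F us v =
     Node (map (\<lambda>u. plane_tree_at F (removeAll u us) u) (filter (\<lambda>u. {v, u} \<in> F) us))"
  by pat_completeness auto
termination
  by (relation "Wellfounded.measure (\<lambda>(F, us, v). length us)") (auto intro: length_removeAll_less)

declare plane_tree_at.simps [simp del]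

definition plane_forest :: "nat \<Rightarrow> nat set set \<Rightarrow> plane_tree list" where
  "plane_forest m F =
     map (\<lambda>r. plane_tree_at F (sorted_list_of_set (reach F `` {r} - {r})) r) (component_roots m F)"

definition Psi :: "nat \<Rightarrow> nat set set \<Rightarrow> plane_tree list" where
  "Psi m E = plane_forest m (nfs_edges m E)"

text \<open>
  The index type of the ambient space carries no preferred order, so \<open>c\<close> enumerates it: the
  coordinate \<open>x\<^sub>i\<close> is \<open>x $ c i\<close> for \<open>1 \<le> i \<le> CARD('n)\<close>.
\<close>

definition cayley_polytope :: "(nat \<Rightarrow> 'n) \<Rightarrow> real \<Rightarrow> (real ^ 'n::finite) set" where
  "cayley_polytope c t =
     {x. 1 \<le> x $ c 1 \<and> x $ c 1 \<le> 1 + t \<and>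
         (\<forall>i\<in>{2..CARD('n)}. 1 \<le> x $ c i \<and> x $ c i \<le> (1 + t) * x $ c (i - 1))}"

definition tree_polytope :: "(nat \<Rightarrow> 'n) \<Rightarrow> real \<Rightarrow> plane_tree \<Rightarrow> (real ^ 'n::finite) set" where
  "tree_polytope c t T =
     {x. \<forall>a\<in>set (preorder T).
           sorted (1 # map (\<lambda>u. x $ c (nfs_pos T u) / (1 + t) ^ cane_count T u) (children T a)
                     @ [1 + t])}"

definition is_subdivision :: "'a::euclidean_space set set \<Rightarrow> 'a set \<Rightarrow> bool" where
  "is_subdivision \<D> P \<longleftrightarrow>
     polytope P \<and> finite \<D> \<and>
     (\<forall>D\<in>\<D>. polytope D \<and> aff_dim D = int DIM('a)) \<and>
     \<Union>\<D> = P \<and>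
     pairwise (\<lambda>A B. interior A \<inter> interior B = {}) \<D>"

end

theory Submission
  imports Defs
begin

text \<open>
  Both the polytopes and the graphs are read off the stack of positioned, not yet active nodes that
  drives the neighbours-first search. When the active node is popped, the cane counts of its
  children are determined by the height of the remaining stack, so a tree amounts to a sequence of
  degree choices made along the stack.

  A graph is decomposed by deleting the active node: its unvisited neighbours are its children,
  while its edges to the remaining stack are never examined and contribute a factor
  \<open>(1 + t) ^ height\<close>. Counting the choices of the child sets gives the multinomial coefficient.

  A point of the Cayley polytope determines the degrees greedily: the active node receives children
  as long as the next coordinate is at least \<open>(1 + t) ^ height\<close>, the height growing by one with
  each child. The choice is forced unless some coordinate equals a power of \<open>1 + t\<close>, which gives
  the subdivision. After rescaling the coordinates, \<open>D\<^sub>T(t)\<close> is the part of a cube of side \<open>t\<close>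
  where each block of sibling coordinates is sorted, so permuting the coordinates within the blocks
  gives its volume.
\<close>

section \<open>Plane forests and the search stack\<close>

definition num_nodes :: "plane_tree list \<Rightarrow> nat" where
  "num_nodes Ts = sum_list (map (\<lambda>T. length (preorder T)) Ts)"

lemma map_preorder_Node:
  "map f (preorder (Node ts)) =
     f [] # concat (map (\<lambda>(i, s). map (\<lambda>u. f (i # u)) (preorder s)) (List.enumerate 0 ts))"
  by (simp add: map_concat o_def case_prod_unfold)

lemma map_enumerate_snd: "map (\<lambda>(i, s). f s) (List.enumerate k ts) = map f ts"
  by (induction ts arbitrary: k) auto

lemma num_nodes_simps [simp]:
  "num_nodes [] = 0"
  "num_nodes (Node ts # st) = Suc (num_nodes (ts @ st))"
  by (simp_all add: num_nodes_def length_concat o_def case_prod_unfold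
      map_enumerate_snd[where f = "\<lambda>s. length (preorder s)", unfolded case_prod_unfold])

lemma num_nodes_append: "num_nodes (Ts @ Us) = num_nodes Ts + num_nodes Us"
  by (simp add: num_nodes_def)

lemma length_le_num_nodes: "length Ts \<le> num_nodes Ts"
proof (induction Ts)
  case (Cons T Ts)
  then show ?case
    by (cases T) (simp add: num_nodes_append)
qed simp

text \<open>Follows one step of the search: the top tree is popped and the subtrees of its root are
  pushed, so \<open>num_nodes\<close> drops by one. Structural induction on trees would lose sight
  of the rest of the stack.\<close>

lemma forest_induct [case_names Nil Node]:
  assumes "P []" and "\<And>ts st. P (ts @ st) \<Longrightarrow> P (Node ts # st)"
  shows "P Ts"
proof (induction Ts rule: measure_induct_rule[where f = num_nodes])
  case (less Ts)
  show ?case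
  proof (cases Ts)
    case Nil
    then show ?thesis using assms(1) by simp
  next
    case (Cons T st)
    obtain ts where "T = Node ts" by (cases T)
    then show ?thesis using Cons less assms(2) by simp
  qed
qed

lemma mem_plane_trees_iff: "T \<in> plane_trees m \<longleftrightarrow> num_nodes [T] = m"
  by (simp add: plane_trees_def num_nodes_def)

lemma finite_forests: "finite {Ts. num_nodes Ts \<le> m}"
proof (induction m)
  case 0
  have "{Ts. num_nodes Ts \<le> 0} \<subseteq> {[]}"
    using length_le_num_nodes le_trans by fastforce
  then show ?case
    by (meson finite.emptyI finite_insert finite_subset)
next
  case (Suc m)
  let ?F = "{Ts. num_nodes Ts \<le> m}"
  have "Ts \<in> insert [] ((\<lambda>(ts, st). Node ts # st) ` (?F \<times> ?F))" if "num_nodes Ts \<le> Suc m" for Ts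
  proof (cases Ts)
    case (Cons T st)
    obtain ts where "T = Node ts" by (cases T)
    then show ?thesis
      using that Cons by (auto simp: num_nodes_append image_iff)
  qed simp
  then have "{Ts. num_nodes Ts \<le> Suc m} \<subseteq> insert [] ((\<lambda>(ts, st). Node ts # st) ` (?F \<times> ?F))"
    by blast
  then show ?case
    using Suc by (meson finite_SigmaI finite_imageI finite_insert finite_subset)
qed

lemma finite_plane_trees: "finite (plane_trees m)"
proof (rule finite_imageD)
  show "finite ((\<lambda>T. [T]) ` plane_trees m)"
    by (rule finite_subset[OF _ finite_forests[of m]]) (auto simp: mem_plane_trees_iff)
qed (simp add: inj_on_def)

section \<open>Node addresses and degree sequences\<close>

lemma degree_at_simps [simp]:
  "degree_at (Node ts) [] = length ts"
  "degree_at (Node ts) (i # u) = degree_at (ts ! i) u"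
  by (simp_all add: degree_at_def)

lemma in_set_enumerate_0: "(i, s) \<in> set (List.enumerate 0 ts) \<longleftrightarrow> i < length ts \<and> s = ts ! i"
  using in_set_enumerate_eq[of "(i, s)" 0 ts] by auto

lemma degree_seq_Node [simp]:
  "degree_seq (Node ts) = length ts # concat (map degree_seq ts)"
proof -
  have "map (\<lambda>(i, s). map (\<lambda>u. degree_at (Node ts) (i # u)) (preorder s)) (List.enumerate 0 ts)
        = map (\<lambda>(i, s). degree_seq s) (List.enumerate 0 ts)"
    by (rule map_cong) (auto simp: in_set_enumerate_0 degree_seq_def)
  then show ?thesis
    unfolding degree_seq_def[of "Node ts"] map_preorder_Node
    using map_enumerate_snd[of degree_seq 0 ts] by simp
qed

lemma mem_preorder_simps [simp]:
  "[] \<in> set (preorder T)"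
  "i # u \<in> set (preorder (Node ts)) \<longleftrightarrow> i < length ts \<and> u \<in> set (preorder (ts ! i))"
proof -
  show "[] \<in> set (preorder T)" by (cases T) simp
  show "i # u \<in> set (preorder (Node ts)) \<longleftrightarrow> i < length ts \<and> u \<in> set (preorder (ts ! i))"
    by (auto simp: in_set_enumerate_0 image_iff Bex_def)
qed

declare preorder.simps [simp del]

lemma snoc_mem_preorder:
  "u @ [i] \<in> set (preorder T) \<longleftrightarrow> u \<in> set (preorder T) \<and> i < degree_at T u"
proof (induction u arbitrary: T)
  case Nil
  then show ?case by (cases T) auto
next
  case (Cons j u)
  then show ?case by (cases T) auto
qed

lemma subtree_at_append: "subtree_at T (u @ v) = subtree_at (subtree_at T u) v"
  by (induction u arbitrary: T) auto

lemma distinct_preorder: "distinct (preorder T)"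
proof (induction T)
  case (Node ts)
  have "distinct (concat (map (\<lambda>(i, s). map ((#) i) (preorder s)) (List.enumerate k ts)))" for k
    using Node
  proof (induction ts arbitrary: k)
    case (Cons s ts)
    have *: "distinct (concat (map (\<lambda>(i, s). map ((#) i) (preorder s)) (List.enumerate (Suc k) ts)))"
      using Cons by simp
    show ?case
      using * Cons.prems by (auto simp: distinct_map in_set_enumerate_eq)
  qed simp
  then show ?case
    by (auto simp: preorder.simps)
qed

section \<open>The NFS order as a listing of all nodes\<close>

lemma append_preorder_Node:
  "map ((@) u) (preorder (Node ts)) =
     u # concat (map (\<lambda>(v, s). map ((@) v) (preorder s))
       (map (\<lambda>(i, s). (u @ [i], s)) (List.enumerate 0 ts)))"
proof -
  have "(@) (u @ [i]) = (\<lambda>v. u @ i # v)" for i :: nat by auto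
  then show ?thesis
    by (simp add: map_preorder_Node o_def case_prod_unfold)
qed

text \<open>A node is listed when it is pushed, that is, when its parent is popped. The nodes on the
  stack are therefore already listed and have to be added on the left.\<close>

lemma mset_nfs_visits:
  "mset (map fst st) + mset (nfs_visits st)
   = mset (concat (map (\<lambda>(u, s). map ((@) u) (preorder s)) st))"
proof (induction st rule: nfs_visits.induct)
  case (2 u ts st)
  let ?cs = "map (\<lambda>(i, s). (u @ [i], s)) (List.enumerate 0 ts)"
  show ?case
    using 2[of ?cs] append_preorder_Node[of u ts] by (simp add: Let_def rev_map ac_simps)
qed simp

lemma mset_nfs_order: "mset (nfs_order T) = mset (preorder T)"
proof -
  have "(@) [] = (\<lambda>u. u :: nat list)" by auto
  then show ?thesis
    using mset_nfs_visits[of "[([], T)]"] by (simp add: nfs_order_def)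
qed

lemma distinct_nfs_order: "distinct (nfs_order T)"
  using mset_eq_imp_distinct_iff[OF mset_nfs_order] distinct_preorder by blast

lemma nfs_pos_eq:
  assumes "i < length (nfs_order T)" and "nfs_order T ! i = u"
  shows "nfs_pos T u = i"
  unfolding nfs_pos_def
  using assms distinct_nfs_order[of T] by (auto intro!: the_equality simp: nth_eq_iff_index_eq)

section \<open>Cane paths\<close>

lemma length_cane_path: "cane_path T v \<Longrightarrow> 3 \<le> length v"
  by (auto simp: cane_path_def Let_def)

text \<open>With a single upward step the tail is a pair \<open>[a, a @ [l]]\<close>, too short to
  be a cane path; this is the second alternative. With more upward steps the tail is again a cane
  path.\<close>

lemma cane_path_Cons:
  assumes "v \<noteq> []"
  shows "cane_path T (u # v) \<longleftrightarrow>
     u \<in> set (preorder T) \<and> (\<exists>i. u = hd v @ [i]) \<and>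
     (cane_path T v \<or>
      (\<exists>a i l. u = a @ [i] \<and> i < l \<and> v = [a, a @ [l]] \<and> a @ [l] \<in> set (preorder T)))"
    (is "?L \<longleftrightarrow> ?R")
proof (cases "length v \<le> 2")
  case True
  then consider a where "v = [a]" | a b where "v = [a, b]"
    using assms by (cases v; cases "tl v") auto
  then show ?thesis
  proof cases
    case 1
    then show ?thesis by (auto simp: cane_path_def)
  next
    case 2
    then show ?thesis
      by (auto simp: cane_path_def snoc_mem_preorder)
  qed
next
  case False
  then obtain k where k: "length v = Suc (Suc (Suc k))"
    by (metis add_2_eq_Suc le_Suc_ex less_eq_Suc_le not_less plus_nat.simps(2))
  have hd: "hd v = v ! 0" using assms by (simp add: hd_conv_nth)
  have all: "(\<forall>m<Suc (Suc k). P m) \<longleftrightarrow> P 0 \<and> (\<forall>m<Suc k. P (Suc m))" for P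
    by (simp add: All_less_Suc2)
  have "\<nexists>a i l. u = a @ [i] \<and> i < l \<and> v = [a, a @ [l]] \<and> a @ [l] \<in> set (preorder T)"
    using k by auto
  moreover have "v ! Suc (Suc k) \<in> set v" using k by simp
  ultimately show ?thesis
    using k unfolding cane_path_def Let_def by (simp add: hd all) (auto simp: numeral_2_eq_2)
qed

text \<open>The first step of a cane path climbs to a parent, and the root has none.\<close>

lemma cane_paths_root: "{v. cane_path T v \<and> hd v = []} = {}"
proof -
  have "hd v \<noteq> []" if cane: "cane_path T v" for v
  proof
    assume "hd v = []"
    then obtain w where "v = [] # w" "2 \<le> length w"
      using length_cane_path[of T v] cane by (cases v) auto
    then have "v = [] # w" "w \<noteq> []" by auto
    then show False
      using cane by (simp add: cane_path_Cons)
  qed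
  then show ?thesis by blast
qed

lemma cane_count_Nil [simp]: "cane_count T [] = 0"
  by (simp only: cane_count_def cane_paths_root card.empty)

text \<open>After the forced step from \<open>u @ [i]\<close> to \<open>u\<close>, the path either
  continues as a cane path from \<open>u\<close> or turns at once to a sibling further right. Thus a
  child exceeds the cane count of its parent by its number of right siblings.\<close>

lemma cane_paths_snoc:
  assumes "u @ [i] \<in> set (preorder T)"
  shows "{v. cane_path T v \<and> hd v = u @ [i]} =
     (#) (u @ [i]) ` {v. cane_path T v \<and> hd v = u} \<union>
     (\<lambda>l. [u @ [i], u, u @ [l]]) ` {i<..<degree_at T u}" (is "?L = ?R")
proof
  show "?L \<subseteq> ?R"
  proof
    fix v assume v: "v \<in> ?L"
    then obtain w where w: "v = (u @ [i]) # w" "2 \<le> length w"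
      using length_cane_path[of T v] by (cases v) auto
    then have "w \<noteq> []" by auto
    show "v \<in> ?R"
      using v w \<open>w \<noteq> []\<close> by (auto simp: cane_path_Cons snoc_mem_preorder)
  qed
  have "cane_path T ((u @ [i]) # w)" if "cane_path T w" "hd w = u" for w
    using that assms length_cane_path[of T w] by (subst cane_path_Cons) auto
  then show "?R \<subseteq> ?L"
    using assms by (auto simp: cane_path_Cons snoc_mem_preorder)
qed

lemma finite_cane_paths:
  assumes "u \<in> set (preorder T)"
  shows "finite {v. cane_path T v \<and> hd v = u}"
  using assms
proof (induction u rule: rev_induct)
  case Nil
  show ?case by (simp only: cane_paths_root finite.emptyI)
next
  case (snoc i u)
  then show ?case
    by (simp add: cane_paths_snoc) (simp add: snoc_mem_preorder)
qed

lemma cane_count_snoc: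
  assumes "u @ [i] \<in> set (preorder T)"
  shows "cane_count T (u @ [i]) = cane_count T u + (degree_at T u - Suc i)"
proof -
  have u: "u \<in> set (preorder T)" using assms by (simp add: snoc_mem_preorder)
  \<comment> \<open>A list of two nodes is too short for a cane path, so the two families in
    \<open>cane_paths_snoc\<close> are disjoint.\<close>
  have "\<not> cane_path T [u, u @ [l]]" for l
    using length_cane_path by force
  then show ?thesis
    unfolding cane_count_def cane_paths_snoc[OF assms]
    by (subst card_Un_disjoint) (auto simp: finite_cane_paths[OF u] card_image inj_on_def)
qed

text \<open>
  The pairs (NFS position, cane count) of the children of each node, left to right, in the order of
  activation. The argument \<open>p\<close> is the next unused position; children are positioned from right to
  left, whence the reversal.
\<close>

function blocks :: "nat \<Rightarrow> plane_tree list \<Rightarrow> (nat \<times> nat) list list" where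
  "blocks p [] = []"
| "blocks p (Node ts # st) =
     rev (map (\<lambda>i. (p + i, length st + i)) [0..<length ts]) # blocks (p + length ts) (ts @ st)"
  by pat_completeness auto
termination
  by (relation "Wellfounded.measure (\<lambda>(p, Ts). num_nodes Ts)") auto

text \<open>The second assumption is the central invariant: a stack node starts as many cane paths
  as there are nodes below it on the stack. When \<open>u\<close> is popped, its count is the height
  of the remaining stack; each child is pushed above its right siblings, whose number is exactly
  what its cane count gains over that of \<open>u\<close>. The list \<open>vs\<close> holds the
  nodes positioned so far.\<close>

lemma blocks_eq_preorder:
  assumes "\<And>u s. (u, s) \<in> set st \<Longrightarrow> u \<in> set (preorder T) \<and> s = subtree_at T u"
    and "map (\<lambda>(u, s). cane_count T u) st = rev [0..<length st]"
    and "nfs_order T = vs @ nfs_visits st"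
  shows "blocks (length vs) (map snd st) =
     map (\<lambda>a. map (\<lambda>u. (nfs_pos T u, cane_count T u)) (children T a))
       (concat (map (\<lambda>(u, s). map ((@) u) (preorder s)) st))"
  using assms
proof (induction st arbitrary: vs rule: nfs_visits.induct)
  case (2 u ts st)
  let ?cs = "map (\<lambda>(i, s). (u @ [i], s)) (List.enumerate 0 ts)"
  have u: "u \<in> set (preorder T)" "subtree_at T u = Node ts"
    using "2.prems"(1)[of u "Node ts"] by auto
  then have deg: "degree_at T u = length ts"
    by (simp add: degree_at_def)
  have child: "u @ [i] \<in> set (preorder T)" "subtree_at T (u @ [i]) = ts ! i" if "i < length ts" for i
    using that u deg by (simp_all add: snoc_mem_preorder subtree_at_append)
  have cane: "cane_count T u = length st" "map (\<lambda>(u, s). cane_count T u) st = rev [0..<length st]"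
    using "2.prems"(2) by auto
  have cane': "cane_count T (u @ [i]) = length st + (length ts - Suc i)" if "i < length ts" for i
    using cane_count_snoc[OF child(1)[OF that]] cane deg by simp
  have visits: "nfs_order T = (vs @ map fst (rev ?cs)) @ nfs_visits (?cs @ st)"
    using "2.prems"(3) by (simp add: Let_def)
  have pos: "nfs_pos T (u @ [i]) = length vs + (length ts - Suc i)" if "i < length ts" for i
    using that
    by (intro nfs_pos_eq) (auto simp: visits nth_append rev_nth nth_enumerate_eq)
  have IH: "blocks (length (vs @ map fst (rev ?cs))) (map snd (?cs @ st)) =
     map (\<lambda>a. map (\<lambda>u. (nfs_pos T u, cane_count T u)) (children T a))
       (concat (map (\<lambda>(u, s). map ((@) u) (preorder s)) (?cs @ st)))"
  proof (rule "2.IH"[OF refl])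
    show "v \<in> set (preorder T) \<and> s = subtree_at T v" if "(v, s) \<in> set (?cs @ st)" for v s
      using that "2.prems"(1) child by (auto simp: in_set_enumerate_0)
    have "map (\<lambda>(u, s). cane_count T u) ?cs = rev [length st..<length st + length ts]"
      by (rule nth_equalityI) (auto simp: nth_enumerate_eq cane' rev_nth)
    moreover have "[0..<length st + length ts] = [0..<length st] @ [length st..<length st + length ts]"
      using upt_add_eq_append by blast
    ultimately show "map (\<lambda>(u, s). cane_count T u) (?cs @ st) = rev [0..<length (?cs @ st)]"
      using cane by (simp add: add.commute)
    show "nfs_order T = (vs @ map fst (rev ?cs)) @ nfs_visits (?cs @ st)"
      by (rule visits)
  qed
  have "map snd ?cs = ts"
    by (simp add: o_def case_prod_unfold)
  moreover have "map ((@) u) (preorder (Node ts))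
        = u # concat (map (\<lambda>(v, s). map ((@) v) (preorder s)) ?cs)"
    by (rule append_preorder_Node)
  moreover have "rev (map (\<lambda>i. (length vs + i, length st + i)) [0..<length ts]) =
      map (\<lambda>u. (nfs_pos T u, cane_count T u)) (children T u)"
    by (rule nth_equalityI) (auto simp: children_def deg rev_nth pos cane')
  ultimately show ?case
    using IH by simp
qed simp

text \<open>The root has position 0 and cane count 0, so the invariant holds initially and the next
  position is 1.\<close>

corollary blocks_plane_tree:
  "blocks 1 [T] = map (\<lambda>a. map (\<lambda>u. (nfs_pos T u, cane_count T u)) (children T a)) (preorder T)"
  using blocks_eq_preorder[of "[([], T)]" T "[[]]"]
  by (auto simp: nfs_order_def map_idI)

lemma length_blocks: "map length (blocks p Ts) = concat (map degree_seq Ts)"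
  by (induction p Ts rule: blocks.induct) auto

text \<open>The roots of \<open>Ts\<close> were positioned when pushed, so only their proper
  descendants take new positions. Reversing each block restores the right-to-left order of
  positioning.\<close>

lemma positions_blocks:
  "map fst (concat (map rev (blocks p Ts))) = [p..<p + (num_nodes Ts - length Ts)]"
proof (induction p Ts rule: blocks.induct)
  case (2 p ts st)
  have "length ts + length st \<le> num_nodes (ts @ st)"
    using length_le_num_nodes[of "ts @ st"] by simp
  then have "[p..<p + (num_nodes (ts @ st) - length st)] =
      [p..<p + length ts] @ [p + length ts..<p + length ts + (num_nodes (ts @ st) - length (ts @ st))]"
    using upt_add_eq_append[of p "p + length ts" "num_nodes (ts @ st) - length (ts @ st)"] by simp
  moreover have "map (\<lambda>i. p + i) [0..<length ts] = [p..<p + length ts]"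
    by (rule nth_equalityI) auto
  ultimately show ?case
    using 2 by (simp add: o_def)
qed simp

text \<open>The number of edges of the graph that the search may have or lack without any effect.\<close>

function stack_weight :: "plane_tree list \<Rightarrow> nat" where
  "stack_weight [] = 0"
| "stack_weight (Node ts # st) = length st + stack_weight (ts @ st)"
  by pat_completeness auto
termination
  by (relation "Wellfounded.measure num_nodes") auto

text \<open>Popping a node contributes the height of the stack below it, which is also its exponent
  in \<open>blocks\<close>. The initial stack nodes lie in no block; their heights
  \<open>0, ..., length Ts - 1\<close> make up the extra sum on the left.\<close>

lemma exponents_blocks:
  "sum_list (map snd (concat (blocks p Ts))) + (\<Sum>i<length Ts. i) = stack_weight Ts"
proof (induction p Ts rule: blocks.induct)
  case (2 p ts st)
  have "sum_list (map (\<lambda>i. length st + i) [0..<length ts]) + (\<Sum>i<length st. i)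
        = (\<Sum>i<length ts + length st. i)"
    by (induction ts) auto
  then show ?case
    using 2 by (simp add: rev_map[symmetric] o_def)
qed simp

lemma length_degree_seqs: "length (concat (map degree_seq Ts)) = num_nodes Ts"
  by (simp add: length_concat num_nodes_def degree_seq_def o_def)

lemma sum_degree_seqs: "sum_list (concat (map degree_seq Ts)) + length Ts = num_nodes Ts"
  by (induction Ts rule: forest_induct) auto

text \<open>A new first node moves every other degree one place on, which adds the sum of those
  degrees, \<open>?N - length ts - length st\<close>, to the weighted sum, besides its own term
  \<open>length ts\<close>. The binomial coefficient grows by \<open>?N\<close>, so the net gain is
  \<open>length st\<close>, the weight of this step.\<close>

lemma stack_weight_eq:
  defines "ds \<equiv> \<lambda>Ts. concat (map degree_seq Ts)"
  shows "int (stack_weight Ts)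
     = int (num_nodes Ts choose 2) - (\<Sum>i<num_nodes Ts. (int i + 1) * int (ds Ts ! i))"
proof (induction Ts rule: forest_induct)
  case (Node ts st)
  let ?N = "num_nodes (ts @ st)" and ?d = "ds (ts @ st)"
  have ds: "ds (Node ts # st) = length ts # ?d"
    by (simp add: ds_def)
  have len: "length ?d = ?N"
    unfolding ds_def by (rule length_degree_seqs)
  have "sum_list ?d + length ts + length st = ?N"
    using sum_degree_seqs[of "ts @ st"] by (simp add: ds_def)
  then have "(\<Sum>i<?N. int (?d ! i)) = int ?N - int (length ts) - int (length st)"
    using len by (simp add: sum_list_sum_nth atLeast0LessThan flip: of_nat_sum)
  moreover have "(\<Sum>i<Suc ?N. (int i + 1) * int (ds (Node ts # st) ! i)) =
      int (length ts) + (\<Sum>i<?N. (int i + 1) * int (?d ! i)) + (\<Sum>i<?N. int (?d ! i))"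
    by (subst sum.lessThan_Suc_shift) (simp add: ds algebra_simps sum.distrib sum_distrib_left)
  moreover have "Suc ?N choose 2 = ?N + (?N choose 2)"
    by (simp add: numeral_2_eq_2)
  ultimately show ?case
    using Node by simp
qed (simp add: ds_def)

section \<open>Graphs with a given search tree\<close>

text \<open>
  The trees below the nodes of the stack \<open>st\<close> in the search forest, obtained by the recursion of
  \<open>nfs_search\<close> rather than by descending the finished forest.
\<close>

function nfs_forest :: "nat set set \<Rightarrow> nat list \<Rightarrow> nat list \<Rightarrow> plane_tree list" where
  "nfs_forest E us [] = []"
| "nfs_forest E us (a # st) =
     (let new = filter (\<lambda>u. {a, u} \<in> E) us;
          Ts = nfs_forest E (filter (\<lambda>u. {a, u} \<notin> E) us) (rev new @ st)
      in Node (take (length new) Ts) # drop (length new) Ts)"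
  by pat_completeness auto
termination
proof (relation "Wellfounded.measure (\<lambda>(E, us, st). 2 * length us + length st)", goal_cases)
  case (2 E us a st new)
  then show ?case
    using sum_length_filter_compl[of "\<lambda>u. {a, u} \<in> E" us] by simp
qed simp

text \<open>The nodes of \<open>us\<close> that the search never visits.\<close>

function nfs_rest :: "nat set set \<Rightarrow> nat list \<Rightarrow> nat list \<Rightarrow> nat list" where
  "nfs_rest E us [] = us"
| "nfs_rest E us (a # st) =
     nfs_rest E (filter (\<lambda>u. {a, u} \<notin> E) us) (rev (filter (\<lambda>u. {a, u} \<in> E) us) @ st)"
  by pat_completeness auto
termination
proof (relation "Wellfounded.measure (\<lambda>(E, us, st). 2 * length us + length st)", goal_cases)
  case (2 E us a st)
  then show ?case
    using sum_length_filter_compl[of "\<lambda>u. {a, u} \<in> E" us] by simp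
qed simp

declare nfs_search.simps(2) [simp del] nfs_forest.simps(2) [simp del]

lemma length_nfs_forest [simp]: "length (nfs_forest E us st) = length st"
  by (induction E us st rule: nfs_forest.induct) (auto simp: nfs_forest.simps(2) Let_def)

lemma nfs_forest_Cons_eq_iff:
  "nfs_forest E us (a # st) = Node ts # Ts \<longleftrightarrow>
     length (filter (\<lambda>u. {a, u} \<in> E) us) = length ts \<and>
     nfs_forest E (filter (\<lambda>u. {a, u} \<notin> E) us) (rev (filter (\<lambda>u. {a, u} \<in> E) us) @ st) = ts @ Ts"
  (is "_ \<longleftrightarrow> length ?new = _ \<and> ?R = _")
proof -
  have "take k R = ts \<and> drop k R = Ts \<longleftrightarrow> k = length ts \<and> R = ts @ Ts"
    if "k \<le> length R" for k :: nat and R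
    using that append_take_drop_id[of k R] by auto
  from this[of "length ?new" ?R] show ?thesis
    by (simp add: nfs_forest.simps(2) Let_def)
qed

text \<open>Every pair tested by the search contains an unvisited node of \<open>us\<close>; edges
  inside the stack are never tested and may be chosen freely.\<close>

lemma nfs_forest_cong:
  assumes "\<And>x y. x \<in> set st \<union> set us \<Longrightarrow> y \<in> set us \<Longrightarrow> {x, y} \<in> E \<longleftrightarrow> {x, y} \<in> E'"
  shows "nfs_forest E us st = nfs_forest E' us st"
  using assms
proof (induction E us st rule: nfs_forest.induct)
  case (2 E us a st)
  have eq: "filter (\<lambda>u. {a, u} \<in> E) us = filter (\<lambda>u. {a, u} \<in> E') us"
    "filter (\<lambda>u. {a, u} \<notin> E) us = filter (\<lambda>u. {a, u} \<notin> E') us"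
    using "2.prems"[of a] by (auto intro: filter_cong)
  have "nfs_forest E (filter (\<lambda>u. {a, u} \<notin> E) us) (rev (filter (\<lambda>u. {a, u} \<in> E) us) @ st)
      = nfs_forest E' (filter (\<lambda>u. {a, u} \<notin> E) us) (rev (filter (\<lambda>u. {a, u} \<in> E) us) @ st)"
    using "2.prems" by (intro "2.IH"[OF refl]) auto
  then show ?case
    by (simp add: nfs_forest.simps(2) Let_def eq)
qed simp

lemma nfs_search_subset:
  "e \<in> set (nfs_search E us st) \<Longrightarrow> e \<in> E \<and> e \<subseteq> set us \<union> set st"
  by (induction E us st rule: nfs_search.induct) (auto simp: nfs_search.simps(2) Let_def)

lemma nfs_rest_subset: "set (nfs_rest E us st) \<subseteq> set us"
  by (induction E us st rule: nfs_rest.induct) auto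

text \<open>Every visited node becomes active at some time, and then all its unvisited neighbours
  are visited.\<close>

lemma nfs_rest_isolated:
  assumes "distinct (us @ st)" and "x \<in> set (nfs_rest E us st)"
    and "y \<in> set us \<union> set st" and "y \<notin> set (nfs_rest E us st)"
  shows "{y, x} \<notin> E"
  using assms
proof (induction E us st rule: nfs_rest.induct)
  case (2 E us a st)
  then show ?case
    using nfs_rest_subset[of E "filter (\<lambda>u. {a, u} \<notin> E) us"
        "rev (filter (\<lambda>u. {a, u} \<in> E) us) @ st"]
    by (cases "y = a") auto
qed simp

lemma num_nodes_nfs_forest:
  "num_nodes (nfs_forest E us st) + length (nfs_rest E us st) = length us + length st"
proof (induction E us st rule: nfs_forest.induct)
  case (2 E us a st)
  then show ?case
    using sum_length_filter_compl[of "\<lambda>u. {a, u} \<in> E" us]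
    by (simp add: nfs_forest.simps(2) Let_def)
qed simp

section \<open>Reachability and connected graphs\<close>

lemma reach_mono: "E \<subseteq> F \<Longrightarrow> reach E \<subseteq> reach F"
  unfolding reach_def by (rule rtrancl_mono) auto

lemma sym_reach: "(a, b) \<in> reach E \<Longrightarrow> (b, a) \<in> reach E"
  using sym_rtrancl[of "{(a, b). {a, b} \<in> E}"] by (auto simp: reach_def sym_def insert_commute)

lemma reach_trans: "(a, b) \<in> reach E \<Longrightarrow> (b, c) \<in> reach E \<Longrightarrow> (a, c) \<in> reach E"
  unfolding reach_def by (rule rtrancl_trans)

lemma reach_nfs_search:
  assumes "v \<in> set us \<union> set st" and "v \<notin> set (nfs_rest E us st)"
  shows "\<exists>a\<in>set st. (a, v) \<in> reach (set (nfs_search E us st))"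
  using assms
proof (induction E us st rule: nfs_search.induct)
  case (2 E us a st)
  let ?new = "filter (\<lambda>u. {a, u} \<in> E) us"
  let ?F = "set (nfs_search E (filter (\<lambda>u. {a, u} \<notin> E) us) (rev ?new @ st))"
  let ?F' = "set (nfs_search E us (a # st))"
  have F': "?F' = (\<lambda>u. {a, u}) ` set ?new \<union> ?F"
    by (simp add: nfs_search.simps(2) Let_def)
  then have sub: "reach ?F \<subseteq> reach ?F'"
    by (intro reach_mono) simp
  have new: "(a, u) \<in> reach ?F'" if "u \<in> set ?new" for u
    unfolding reach_def using that F' by (intro r_into_rtrancl) auto
  show ?case
  proof (cases "v = a")
    case True
    then show ?thesis by (auto simp: reach_def)
  next
    case False
    then obtain b where b: "b \<in> set (rev ?new @ st)" "(b, v) \<in> reach ?F"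
      using "2.IH"[OF refl] "2.prems" by auto
    then show ?thesis
      using new sub by (auto intro: reach_trans)
  qed
qed simp

text \<open>
  The list \<open>L\<close> may contain siblings and nodes that have already been active; the last assumption
  excludes the parents of \<open>st ! i\<close> and of the nodes in \<open>us\<close>.
\<close>

lemma plane_tree_at_nfs_search:
  assumes "sorted (rev us)" and "distinct (us @ st)" and "set (nfs_search E us st) \<subseteq> F"
    and "i < length st" and "sorted L" and "distinct L" and "set us \<subseteq> set L" and "st ! i \<notin> set L"
    and "\<And>x y. x \<in> insert (st ! i) (set us) \<Longrightarrow> y \<in> set L \<Longrightarrow> {x, y} \<in> F
           \<Longrightarrow> {x, y} \<in> set (nfs_search E us st)"
  shows "plane_tree_at F L (st ! i) = nfs_forest E us st ! i"
  using assms
proof (induction E us st arbitrary: i L rule: nfs_search.induct)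
  case (2 E us a st)
  define new us' where "new = filter (\<lambda>u. {a, u} \<in> E) us" and "us' = filter (\<lambda>u. {a, u} \<notin> E) us"
  define R where "R = nfs_forest E us' (rev new @ st)"
  have search: "nfs_search E us (a # st) = map (\<lambda>u. {a, u}) new @ nfs_search E us' (rev new @ st)"
    by (simp add: nfs_search.simps(2) Let_def new_def us'_def)
  have forest: "nfs_forest E us (a # st) = Node (take (length new) R) # drop (length new) R"
    by (simp add: nfs_forest.simps(2) Let_def new_def us'_def R_def)
  have sub: "e \<subseteq> set us \<union> set st" if "e \<in> set (nfs_search E us' (rev new @ st))" for e
    using nfs_search_subset[OF that] by (auto simp: new_def us'_def)
  have later: "{x, y} \<in> set (nfs_search E us' (rev new @ st))"
    if "{x, y} \<in> set (nfs_search E us (a # st))" "x \<noteq> a" "y \<noteq> a" for x y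
    using that unfolding search by (auto simp: doubleton_eq_iff)
  have IH: "plane_tree_at F M ((rev new @ st) ! j) = R ! j"
    if "j < length (rev new @ st)" "sorted M" "distinct M" "set us' \<subseteq> set M" "(rev new @ st) ! j \<notin> set M"
      and "\<And>x y. x \<in> insert ((rev new @ st) ! j) (set us') \<Longrightarrow> y \<in> set M \<Longrightarrow> {x, y} \<in> F
             \<Longrightarrow> {x, y} \<in> set (nfs_search E us' (rev new @ st))" for j M
    unfolding R_def us'_def new_def
  proof (rule "2.IH"[OF refl])
    show "sorted (rev (filter (\<lambda>u. {a, u} \<notin> E) us))"
      using "2.prems"(1) by (simp add: rev_filter sorted_wrt_filter)
  qed (use that "2.prems"(2,3) in \<open>auto simp: nfs_search.simps(2) new_def us'_def Let_def\<close>)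
  show ?case
  proof (cases i)
    case 0
    have a: "a \<notin> set us \<union> set st" "a \<notin> set L"
      using "2.prems"(2,8) 0 by auto
    \<comment> \<open>By the last assumption the edge \<open>{a, u}\<close> is a search edge, and
      search edges found after \<open>a\<close> has been popped avoid \<open>a\<close>.\<close>
    have "u \<in> set new" if "u \<in> set L" "{a, u} \<in> F" for u
    proof -
      have "{a, u} \<in> set (nfs_search E us (a # st))"
        using "2.prems"(9)[of a u] that 0 by simp
      then show ?thesis
        using sub[of "{a, u}"] a unfolding search by (auto simp: doubleton_eq_iff)
    qed
    moreover have "u \<in> set L \<and> {a, u} \<in> F" if "u \<in> set new" for u
      using that "2.prems"(3,7) unfolding search by (auto simp: new_def)
    ultimately have set_eq: "set (filter (\<lambda>u. {a, u} \<in> F) L) = set (rev new)"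
      by auto
    have "sorted (rev new)" "distinct new"
      using "2.prems"(1,2) by (simp_all add: new_def rev_filter sorted_wrt_filter)
    \<comment> \<open>\<open>new\<close> is decreasing and \<open>L\<close> increasing, whence the
      reversal.\<close>
    then have filter_L: "filter (\<lambda>u. {a, u} \<in> F) L = rev new"
      using set_eq "2.prems"(5,6) by (intro sorted_distinct_set_unique) (auto simp: sorted_wrt_filter)
    have "plane_tree_at F (removeAll (rev new ! j) L) (rev new ! j) = R ! j" if j: "j < length new" for j
    proof -
      have mem: "rev new ! j \<in> set new"
        using j nth_mem[of j "rev new"] by simp
      then have "rev new ! j \<in> set us" "rev new ! j \<notin> set us'"
        by (auto simp: new_def us'_def)
      then have "plane_tree_at F (removeAll (rev new ! j) L) ((rev new @ st) ! j) = R ! j"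
      proof (intro IH)
        fix x y assume x: "x \<in> insert ((rev new @ st) ! j) (set us')"
          and y: "y \<in> set (removeAll (rev new ! j) L)" and "{x, y} \<in> F"
        have "x \<in> set us"
          using x j mem by (auto simp: nth_append new_def us'_def)
        then have "{x, y} \<in> set (nfs_search E us (a # st))"
          using y \<open>{x, y} \<in> F\<close> by (intro "2.prems"(9)) auto
        then show "{x, y} \<in> set (nfs_search E us' (rev new @ st))"
          using a y \<open>x \<in> set us\<close> by (intro later) auto
      qed (use j "2.prems"(5,6,7) in \<open>auto simp: nth_append removeAll_filter_not_eq sorted_wrt_filter us'_def\<close>)
      then show ?thesis
        using j by (simp add: nth_append)
    qed
    then have "map (\<lambda>u. plane_tree_at F (removeAll u L) u) (rev new) = take (length new) R"
      by (intro nth_equalityI) (auto simp: R_def)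
    then show ?thesis
      by (subst plane_tree_at.simps) (simp add: 0 filter_L forest)
  next
    case (Suc j)
    have j: "st ! j = (rev new @ st) ! (length new + j)" "j < length st"
      using "2.prems"(4) Suc by (auto simp: nth_append)
    have "plane_tree_at F L (st ! j) = R ! (length new + j)"
      unfolding j(1)
    proof (rule IH)
      fix x y assume x: "x \<in> insert ((rev new @ st) ! (length new + j)) (set us')"
        and y: "y \<in> set L" and "{x, y} \<in> F"
      have x': "x \<in> insert (st ! j) (set us')"
        using x j by simp
      have search_xy: "{x, y} \<in> set (nfs_search E us (a # st))"
        using x' y Suc \<open>{x, y} \<in> F\<close> by (intro "2.prems"(9)) (auto simp: us'_def)
      have "x \<noteq> a" "x \<notin> set new"
        using x' j(2) "2.prems"(2) nth_mem[OF j(2)] by (auto simp: new_def us'_def)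
      \<comment> \<open>A search edge between \<open>x\<close> and \<open>a\<close> would put
        \<open>x\<close> into \<open>new\<close>, since later search edges avoid
        \<open>a\<close>.\<close>
      then have "y \<noteq> a"
        using search_xy sub[of "{x, y}"] "2.prems"(2) unfolding search by (auto simp: doubleton_eq_iff)
      then show "{x, y} \<in> set (nfs_search E us' (rev new @ st))"
        using search_xy \<open>x \<noteq> a\<close> by (intro later)
    qed (use "2.prems"(4-8) Suc in \<open>auto simp: us'_def nth_append\<close>)
    then show ?thesis
      by (simp add: Suc forest R_def)
  qed
qed simp

lemma reach_within:
  assumes "E \<in> labeled_graphs m" and "(a, b) \<in> reach E" and "a \<in> {1..m}"
  shows "b \<in> {1..m}"
  using assms(2,3) unfolding reach_def
  by (induction rule: rtrancl_induct) (use assms(1) in \<open>auto simp: labeled_graphs_def\<close>)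

lemma graph_connected_reach:
  assumes "E \<in> labeled_graphs m" and "graph_connected m E" and "a \<in> {1..m}"
  shows "reach E `` {a} = {1..m}"
  using assms reach_within[OF assms(1) _ assms(3)] unfolding graph_connected_def by blast

lemma component_roots_connected:
  assumes "E \<in> labeled_graphs m" and "graph_connected m E" and "1 \<le> m"
  shows "component_roots m E = [m]"
proof -
  have "components_of_graph m E = (\<lambda>a. {1..m}) ` {1..m}"
    unfolding components_of_graph_def
    using graph_connected_reach[OF assms(1,2)] by (intro image_cong) auto
  moreover have "Max {1..m} = m"
    using assms(3) by (intro Max_eqI) auto
  ultimately show ?thesis
    using assms(3) by (simp add: component_roots_def image_constant_conv)
qed

lemma nfs_search_in_labeled_graphs:
  "E \<in> labeled_graphs m \<Longrightarrow> set (nfs_search E us st) \<in> labeled_graphs m"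
  using nfs_search_subset unfolding labeled_graphs_def by blast

lemma nfs_edges_subset: "nfs_edges m E \<subseteq> E"
  by (auto simp: nfs_edges_def dest: nfs_search_subset)

text \<open>Search edges are edges of \<open>E\<close>, so nodes separated in \<open>E\<close> stay
  separated in the search forest. Their components there have different maxima, hence there are at
  least two roots.\<close>

lemma not_connected_Psi:
  assumes E: "E \<in> labeled_graphs m" and "\<not> graph_connected m E"
  shows "Psi m E \<noteq> [T]"
proof -
  let ?F = "nfs_edges m E"
  have F: "?F \<in> labeled_graphs m"
    using E nfs_edges_subset[of m E] by (auto simp: labeled_graphs_def)
  obtain a b where ab: "a \<in> {1..m}" "b \<in> {1..m}" "(a, b) \<notin> reach E"
    using assms(2) by (auto simp: graph_connected_def)
  have Max_in: "Max (reach ?F `` {x}) \<in> reach ?F `` {x}" if "x \<in> {1..m}" for x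
  proof (rule Max_in)
    have "reach ?F `` {x} \<subseteq> {1..m}"
      using reach_within[OF F] that by auto
    then show "finite (reach ?F `` {x})"
      by (rule finite_subset) simp
    show "reach ?F `` {x} \<noteq> {}" by (auto simp: reach_def)
  qed
  have "Max (reach ?F `` {a}) \<noteq> Max (reach ?F `` {b})"
  proof
    assume *: "Max (reach ?F `` {a}) = Max (reach ?F `` {b})"
    have "(a, b) \<in> reach ?F"
      using Max_in[OF ab(1)] Max_in[OF ab(2)] unfolding * by (auto intro: reach_trans sym_reach)
    then show False
      using ab(3) reach_mono[OF nfs_edges_subset] by blast
  qed
  moreover have "{Max (reach ?F `` {a}), Max (reach ?F `` {b})} \<subseteq> Max ` components_of_graph m ?F"
    using ab by (auto simp: components_of_graph_def)
  moreover have "finite (Max ` components_of_graph m ?F)"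
    by (simp add: components_of_graph_def)
  ultimately have "2 \<le> card (Max ` components_of_graph m ?F)"
    by (metis card_2_iff card_mono)
  then have "length (Psi m E) \<noteq> 1"
    by (simp add: Psi_def plane_forest_def component_roots_def)
  then show ?thesis by auto
qed

text \<open>The visited nodes include \<open>m\<close> and, by \<open>nfs_rest_isolated\<close>, are
  closed under adjacency.\<close>

lemma nfs_rest_connected:
  assumes E: "E \<in> labeled_graphs m" and "graph_connected m E" and "1 \<le> m"
  shows "nfs_rest E (rev [1..<m]) [m] = []"
proof -
  let ?R = "set (nfs_rest E (rev [1..<m]) [m])"
  have R: "?R \<subseteq> {1..<m}"
    using nfs_rest_subset[of E "rev [1..<m]" "[m]"] by simp
  have visited: "v \<in> {1..m} - ?R" if "(m, v) \<in> reach E" for v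
    using that unfolding reach_def
  proof (induction rule: rtrancl_induct)
    case base
    then show ?case using R assms(3) by auto
  next
    case (step x y)
    then have "y \<in> {1..m}"
      using E by (auto simp: labeled_graphs_def)
    moreover have "y \<notin> ?R"
      using nfs_rest_isolated[of "rev [1..<m]" "[m]" y E x] step by force
    ultimately show ?case by simp
  qed
  have "?R = {}"
  proof (rule equals0I)
    fix v assume v: "v \<in> ?R"
    then have "(m, v) \<in> reach E"
      using R assms(2,3) by (force simp: graph_connected_def)
    then show False
      using visited v by blast
  qed
  then show ?thesis by simp
qed

lemma connected_nfs_search:
  assumes "1 \<le> m" and "nfs_rest E (rev [1..<m]) [m] = []"
  shows "graph_connected m (set (nfs_search E (rev [1..<m]) [m]))"
proof -
  have "(m, v) \<in> reach (set (nfs_search E (rev [1..<m]) [m]))" if "v \<in> {1..m}" for v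
    using reach_nfs_search[of v "rev [1..<m]" "[m]" E] that assms by force
  then show ?thesis
    unfolding graph_connected_def by (blast intro: reach_trans sym_reach)
qed

text \<open>The search edges form a connected graph again, so \<open>nfs_edges\<close> and
  \<open>plane_forest\<close> both start from the single root \<open>m\<close>. Taking
  \<open>F\<close> to be the set of search edges makes the last assumption of
  \<open>plane_tree_at_nfs_search\<close> trivial.\<close>

lemma Psi_connected:
  assumes E: "E \<in> labeled_graphs m" and conn: "graph_connected m E" and m: "1 \<le> m"
  shows "Psi m E = nfs_forest E (rev [1..<m]) [m]"
proof -
  let ?F = "set (nfs_search E (rev [1..<m]) [m])"
  have F: "?F \<in> labeled_graphs m" "graph_connected m ?F"
    using nfs_search_in_labeled_graphs[OF E] connected_nfs_search[OF m nfs_rest_connected[OF assms]]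
    by auto
  have "{1..m} - {m} = {1..<m}" by auto
  then have list: "sorted_list_of_set ({1..m} - {m}) = [1..<m]"
    by simp
  have "nfs_edges m E = ?F"
    using list graph_connected_reach[OF E conn] m
    by (simp add: nfs_edges_def component_roots_connected[OF assms])
  moreover have "plane_forest m ?F = [plane_tree_at ?F [1..<m] m]"
    using list graph_connected_reach[OF F] m
    unfolding plane_forest_def component_roots_connected[OF F m] by simp
  moreover have "plane_tree_at ?F [1..<m] ([m] ! 0) = nfs_forest E (rev [1..<m]) [m] ! 0"
    by (rule plane_tree_at_nfs_search) auto
  moreover have "[nfs_forest E (rev [1..<m]) [m] ! 0] = nfs_forest E (rev [1..<m]) [m]"
    by (rule nth_equalityI) auto
  ultimately show ?thesis
    by (simp add: Psi_def)
qed

text \<open>Connectedness follows from the size of \<open>T\<close>: a search from \<open>m\<close>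
  that yields a tree with \<open>m\<close> nodes leaves no node unvisited, so its search edges
  connect the graph.\<close>

lemma Psi_eq_iff:
  assumes E: "E \<in> labeled_graphs m" and m: "1 \<le> m" and T: "T \<in> plane_trees m"
  shows "Psi m E = [T] \<longleftrightarrow> nfs_forest E (rev [1..<m]) [m] = [T]"
proof (cases "graph_connected m E")
  case True
  then show ?thesis using Psi_connected[OF E _ m] by simp
next
  case False
  have "nfs_forest E (rev [1..<m]) [m] \<noteq> [T]"
  proof
    assume "nfs_forest E (rev [1..<m]) [m] = [T]"
    then have "nfs_rest E (rev [1..<m]) [m] = []"
      using num_nodes_nfs_forest[of E "rev [1..<m]" "[m]"] T m by (simp add: mem_plane_trees_iff)
    then have "graph_connected m (set (nfs_search E (rev [1..<m]) [m]))"
      by (rule connected_nfs_search[OF m])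
    moreover have "set (nfs_search E (rev [1..<m]) [m]) \<subseteq> E"
      using nfs_search_subset by blast
    ultimately show False
      using False reach_mono unfolding graph_connected_def by blast
  qed
  then show ?thesis
    using not_connected_Psi[OF E False] by simp
qed

lemma ex_Psi_connected:
  assumes "E \<in> labeled_graphs m" and "graph_connected m E" and "1 \<le> m"
  shows "\<exists>T\<in>plane_trees m. Psi m E = [T]"
proof -
  have "length (Psi m E) = 1"
    by (simp add: Psi_connected[OF assms])
  then obtain T where T: "Psi m E = [T]"
    by (auto simp: length_Suc_conv)
  moreover have "num_nodes [T] = m"
    using num_nodes_nfs_forest[of E "rev [1..<m]" "[m]"] nfs_rest_connected[OF assms] T assms(3)
    by (simp add: Psi_connected[OF assms] del: num_nodes_simps)
  ultimately show ?thesis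
    by (auto simp: mem_plane_trees_iff)
qed

section \<open>Weighted sums over graphs on arbitrary vertex sets\<close>

definition graphs_on :: "nat set \<Rightarrow> nat set set set" where
  "graphs_on V = Pow {e. e \<subseteq> V \<and> card e = 2}"

lemma finite_graphs_on: "finite V \<Longrightarrow> finite (graphs_on V)"
  unfolding graphs_on_def
  by (rule finite_Pow_iff[THEN iffD2], rule finite_subset[where B = "Pow V"]) auto

text \<open>Accounts for the free choice of edges from the active node to the stack.\<close>

lemma sum_power_card_Pow:
  fixes t :: real
  assumes "finite A"
  shows "(\<Sum>X\<in>Pow A. t ^ card X) = (1 + t) ^ card A"
  using assms
proof induction
  case (insert a A)
  have "(\<Sum>X\<in>insert a ` Pow A. t ^ card X) = (\<Sum>X\<in>Pow A. t * t ^ card X)"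
  proof (subst sum.reindex)
    show "inj_on (insert a) (Pow A)"
      using insert by (auto simp: inj_on_def)
    show "sum ((\<lambda>X. t ^ card X) \<circ> insert a) (Pow A) = (\<Sum>X\<in>Pow A. t * t ^ card X)"
    proof (intro sum.cong refl)
      fix X assume "X \<in> Pow A"
      then have "finite X" "a \<notin> X"
        using insert finite_subset by auto
      then show "((\<lambda>X. t ^ card X) \<circ> insert a) X = t * t ^ card X"
        by simp
    qed
  qed
  moreover have "Pow A \<inter> insert a ` Pow A = {}"
    using insert by auto
  ultimately show ?case
    using insert by (simp add: Pow_insert sum.union_disjoint sum_distrib_left[symmetric] algebra_simps)
qed simp

text \<open>
  A graph is split into the set \<open>N\<close> of unvisited neighbours of \<open>a\<close>, the set \<open>M\<close> of its neighbours
  on the stack, on which the search does not depend, and the graph \<open>H\<close> left after deleting \<open>a\<close>.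
\<close>

lemma sum_nfs_forest_Cons:
  fixes t :: real
  assumes dist: "distinct (us @ a # st)"
  shows "(\<Sum>G | G \<in> graphs_on (set us \<union> set (a # st)) \<and> nfs_forest G us (a # st) = Node ts # Ts.
            t ^ card G)
    = (\<Sum>N | N \<subseteq> set us \<and> card N = length ts. \<Sum>M\<in>Pow (set st).
        \<Sum>H | H \<in> graphs_on (set us \<union> set st) \<and>
            nfs_forest H (filter (\<lambda>u. u \<notin> N) us) (rev (filter (\<lambda>u. u \<in> N) us) @ st) = ts @ Ts.
          t ^ card N * t ^ card M * t ^ card H)"
proof -
  let ?V = "set us \<union> set st"
  define \<H> where "\<H> N = {H. H \<in> graphs_on ?V \<and>
    nfs_forest H (filter (\<lambda>u. u \<notin> N) us) (rev (filter (\<lambda>u. u \<in> N) us) @ st) = ts @ Ts}" for N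
  let ?\<N> = "{N. N \<subseteq> set us \<and> card N = length ts}"
  let ?I = "SIGMA N:?\<N>. Pow (set st) \<times> \<H> N"
  let ?\<G> = "{G. G \<in> graphs_on (set us \<union> set (a # st)) \<and> nfs_forest G us (a # st) = Node ts # Ts}"
  define join where "join = (\<lambda>(N, M, H). (\<lambda>u. {a, u}) ` (N \<union> M) \<union> (H :: nat set set))"
  define split where "split G = ({u \<in> set us. {a, u} \<in> G}, {u \<in> set st. {a, u} \<in> G},
    {e \<in> G. a \<notin> e})" for G :: "nat set set"
  have a: "a \<notin> set us" "a \<notin> set st" and us_st: "set us \<inter> set st = {}"
    using dist by auto
  have fin: "finite (\<H> N)" for N
    using finite_graphs_on[of ?V] by (auto simp: \<H>_def)
  have forest: "nfs_forest G us (a # st) = Node ts # Ts \<longleftrightarrow> card N = length ts \<and> H \<in> \<H> N"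
    if "split G = (N, M, H)" "G \<in> graphs_on (set us \<union> set (a # st))" for G N M H
  proof -
    have N: "N = {u \<in> set us. {a, u} \<in> G}" and H: "H = {e \<in> G. a \<notin> e}"
      using that by (auto simp: split_def)
    have new: "filter (\<lambda>u. {a, u} \<in> G) us = filter (\<lambda>u. u \<in> N) us"
      "filter (\<lambda>u. {a, u} \<notin> G) us = filter (\<lambda>u. u \<notin> N) us"
      by (auto simp: N intro: filter_cong)
    have "length (filter (\<lambda>u. u \<in> N) us) = card N"
      using dist by (subst distinct_card[symmetric]) (auto simp: N intro: arg_cong[where f = card])
    \<comment> \<open>Once \<open>a\<close> has been popped, no pair containing it is tested, so
      \<open>G\<close> may be replaced by \<open>H\<close>.\<close>
    moreover have "nfs_forest G (filter (\<lambda>u. u \<notin> N) us) (rev (filter (\<lambda>u. u \<in> N) us) @ st)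
        = nfs_forest H (filter (\<lambda>u. u \<notin> N) us) (rev (filter (\<lambda>u. u \<in> N) us) @ st)"
      using a by (intro nfs_forest_cong) (auto simp: H)
    moreover have "H \<in> graphs_on ?V"
      using that(2) by (auto simp: H graphs_on_def)
    ultimately show ?thesis
      by (simp add: nfs_forest_Cons_eq_iff new \<H>_def)
  qed
  have split_join: "split (join (N, M, H)) = (N, M, H)"
    if "N \<subseteq> set us" "M \<subseteq> set st" "H \<in> graphs_on ?V" for N M H
  proof -
    have "a \<notin> e" if "e \<in> H" for e
      using that \<open>H \<in> graphs_on ?V\<close> a by (auto simp: graphs_on_def)
    then show ?thesis
      using that a us_st by (auto simp: split_def join_def doubleton_eq_iff)
  qed
  have join_split: "join (split G) = G" if "G \<in> graphs_on (set us \<union> set (a # st))" for G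
  proof -
    have "\<exists>u\<in>set us \<union> set st. e = {a, u}" if "e \<in> G" "a \<in> e" for e
    proof -
      have e: "e \<subseteq> insert a ?V" "card e = 2"
        using that \<open>G \<in> _\<close> by (auto simp: graphs_on_def)
      then obtain u where "e = {a, u}" "u \<noteq> a"
        using \<open>a \<in> e\<close> by (auto simp: card_2_iff)
      then show ?thesis using e(1) by auto
    qed
    then show ?thesis
      by (auto simp: split_def join_def)
  qed
  have join_mem: "join (N, M, H) \<in> graphs_on (set us \<union> set (a # st))"
    if "N \<subseteq> set us" "M \<subseteq> set st" "H \<in> graphs_on ?V" for N M H
    using that a by (auto simp: join_def graphs_on_def card_insert_if)
  have card_join: "card (join (N, M, H)) = card N + card M + card H"
    if "N \<subseteq> set us" "M \<subseteq> set st" "H \<in> graphs_on ?V" for N M H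
  proof -
    have "finite H"
      using that(3) finite_graphs_on[of ?V]
      by (auto simp: graphs_on_def intro: finite_subset[where B = "Pow ?V"])
    moreover have "finite N" "finite M"
      using that(1,2) finite_subset by blast+
    moreover have "card ((\<lambda>u. {a, u}) ` (N \<union> M)) = card (N \<union> M)"
      by (rule card_image) (auto simp: inj_on_def doubleton_eq_iff)
    moreover have "card (N \<union> M) = card N + card M"
      using that us_st calculation by (intro card_Un_disjoint) auto
    moreover have "(\<lambda>u. {a, u}) ` (N \<union> M) \<inter> H = {}"
      using that(3) a by (auto simp: graphs_on_def)
    ultimately show ?thesis
      by (simp add: join_def card_Un_disjoint)
  qed
  have I: "N \<subseteq> set us \<and> M \<subseteq> set st \<and> H \<in> graphs_on ?V" if "(N, M, H) \<in> ?I" for N M H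
    using that by (auto simp: \<H>_def)
  have "(\<Sum>G\<in>?\<G>. t ^ card G) = (\<Sum>(N, M, H)\<in>?I. t ^ card N * t ^ card M * t ^ card H)"
  proof (rule sum.reindex_bij_witness[of _ join split])
    fix G assume G: "G \<in> ?\<G>"
    obtain N M H where NMH: "split G = (N, M, H)" by (cases "split G")
    then have "N \<subseteq> set us" "M \<subseteq> set st"
      by (auto simp: split_def)
    then show "split G \<in> ?I"
      using G forest[OF NMH] by (simp add: NMH)
    show "join (split G) = G"
      using G join_split by blast
    then show "(case split G of (N, M, H) \<Rightarrow> t ^ card N * t ^ card M * t ^ card H) = t ^ card G"
      using NMH I[of N M H] \<open>split G \<in> ?I\<close> card_join[of N M H] by (simp add: power_add)
  next
    fix x assume x: "x \<in> ?I"
    obtain N M H where x_eq: "x = (N, M, H)" by (cases x)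
    have NMH: "N \<subseteq> set us" "M \<subseteq> set st" "H \<in> graphs_on ?V"
      using x I[of N M H] unfolding x_eq by blast+
    show split: "split (join x) = x"
      unfolding x_eq by (rule split_join[OF NMH])
    have "card N = length ts \<and> H \<in> \<H> N"
      using x unfolding x_eq by blast
    then show "join x \<in> ?\<G>"
      using forest[OF split[unfolded x_eq] join_mem[OF NMH]] join_mem[OF NMH]
      unfolding x_eq by blast
  qed
  also have "\<dots> = (\<Sum>N\<in>?\<N>. \<Sum>M\<in>Pow (set st). \<Sum>H\<in>\<H> N. t ^ card N * t ^ card M * t ^ card H)"
    by (simp only: sum.cartesian_product) (subst sum.Sigma; simp add: fin)
  finally show ?thesis
    by (simp only: \<H>_def)
qed

text \<open>Each of the \<open>?n choose ?k\<close> child sets of the active node leads to the same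
  inner sum; the edges to the children give \<open>t ^ ?k\<close> and the unexamined edges to the
  stack give \<open>(1 + t) ^ length st'\<close>. The factorials combine by
  \<open>(?n choose ?k) * fact (?n - ?k) * fact ?k = fact ?n\<close>.\<close>

lemma sum_graphs_nfs_forest:
  fixes t :: real
  assumes "distinct (us @ st)" and "length Ts = length st" and "num_nodes Ts = length us + length st"
  shows "(\<Sum>G | G \<in> graphs_on (set us \<union> set st) \<and> nfs_forest G us st = Ts. t ^ card G)
           * prod_list (map fact (concat (map degree_seq Ts)))
         = t ^ length us * (1 + t) ^ stack_weight Ts * fact (length us)"
  using assms
proof (induction Ts arbitrary: us st rule: forest_induct)
  case Nil
  then have "{G. G \<in> graphs_on (set us \<union> set st) \<and> nfs_forest G us st = []} = {{}}"
    by (auto simp: graphs_on_def)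
  then show ?case
    using Nil by simp
next
  case (Node ts Us)
  obtain a st' where st: "st = a # st'"
    using Node.prems(2) by (cases st) auto
  let ?n = "length us" and ?k = "length ts"
  let ?w = "stack_weight (ts @ Us)" and ?D = "prod_list (map fact (concat (map degree_seq (ts @ Us)))) :: real"
  have nodes: "num_nodes (ts @ Us) = ?n + length st'" and len: "length Us = length st'"
    using Node.prems st by auto
  then have k: "?k \<le> ?n"
    using length_le_num_nodes[of "ts @ Us"] by simp
  then have t_n: "t ^ ?n = t ^ ?k * t ^ (?n - ?k)"
    by (simp flip: power_add)
  have D: "?D \<noteq> 0"
    by (auto simp: prod_list_zero_iff)
  have inner: "(\<Sum>H | H \<in> graphs_on (set us \<union> set st') \<and>
        nfs_forest H (filter (\<lambda>u. u \<notin> N) us) (rev (filter (\<lambda>u. u \<in> N) us) @ st') = ts @ Us. t ^ card H)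
      = t ^ (?n - ?k) * (1 + t) ^ ?w * fact (?n - ?k) / ?D"
    if N: "N \<subseteq> set us" "card N = ?k" for N
  proof -
    have sets: "set (filter (\<lambda>u. u \<notin> N) us) \<union> set (rev (filter (\<lambda>u. u \<in> N) us) @ st') = set us \<union> set st'"
      by auto
    have "set us \<inter> N = N" using N by auto
    then have "length (filter (\<lambda>u. u \<in> N) us) = card N"
      using Node.prems(1) by (subst distinct_card[symmetric]) (simp_all add: Int_def)
    moreover from this have "length (filter (\<lambda>u. u \<notin> N) us) = ?n - ?k"
      using sum_length_filter_compl[of "\<lambda>u. u \<in> N" us] N by simp
    ultimately show ?thesis
      using Node.IH[of "filter (\<lambda>u. u \<notin> N) us" "rev (filter (\<lambda>u. u \<in> N) us) @ st'"]
        Node.prems(1) nodes len k D N unfolding sets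
      by (auto simp: st field_simps)
  qed
  have "(\<Sum>G | G \<in> graphs_on (set us \<union> set st) \<and> nfs_forest G us st = Node ts # Us. t ^ card G)
      = (\<Sum>N | N \<subseteq> set us \<and> card N = ?k. \<Sum>M\<in>Pow (set st').
          t ^ ?k * t ^ card M * (t ^ (?n - ?k) * (1 + t) ^ ?w * fact (?n - ?k) / ?D))"
    unfolding st using Node.prems(1)[unfolded st]
    by (subst sum_nfs_forest_Cons) (auto simp: sum_distrib_left[symmetric] inner intro!: sum.cong)
  also have "\<dots> = real (?n choose ?k) *
      (t ^ ?k * (1 + t) ^ length st' * (t ^ (?n - ?k) * (1 + t) ^ ?w * fact (?n - ?k) / ?D))"
    using Node.prems(1) n_subsets[of "set us" ?k]
    by (simp add: st sum_distrib_left[symmetric] sum_distrib_right[symmetric] sum_divide_distrib[symmetric]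
        sum_power_card_Pow distinct_card)
  also have "\<dots> = t ^ ?n * (1 + t) ^ stack_weight (Node ts # Us) * (real (?n choose ?k) * fact (?n - ?k)) / ?D"
    using len by (simp add: t_n power_add mult_ac)
  finally show ?case
    using D k by (simp add: binomial_fact field_simps)
qed

lemma sum_graphs_Psi:
  fixes t :: real
  assumes "T \<in> plane_trees (n + 1)"
  shows "(\<Sum>G | G \<in> labeled_graphs (n + 1) \<and> Psi (n + 1) G = [T]. t ^ card G)
           * prod_list (map fact (degree_seq T))
         = t ^ n * (1 + t) ^ stack_weight [T] * fact n"
proof -
  have V: "set (rev [1..<n + 1]) \<union> set [n + 1] = {1..n + 1}" by auto
  have "labeled_graphs (n + 1) = graphs_on {1..n + 1}"
    by (simp add: labeled_graphs_def graphs_on_def)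
  then have "{G. G \<in> labeled_graphs (n + 1) \<and> Psi (n + 1) G = [T]} =
      {G. G \<in> graphs_on (set (rev [1..<n + 1]) \<union> set [n + 1]) \<and> nfs_forest G (rev [1..<n + 1]) [n + 1] = [T]}"
    unfolding V using Psi_eq_iff[OF _ _ assms] by auto
  then show ?thesis
    using sum_graphs_nfs_forest[of "rev [1..<n + 1]" "[n + 1]" "[T]" t] assms
    by (simp add: mem_plane_trees_iff del: num_nodes_simps)
qed

section \<open>The trees selected by a point\<close>

lemma sorted_rev_map_upt:
  fixes z :: "nat \<Rightarrow> real"
  shows "sorted (l # rev (map z [0..<k]) @ [r]) \<longleftrightarrow>
    (if k = 0 then l \<le> r
     else l \<le> z (k - 1) \<and> z 0 \<le> r \<and> (\<forall>i. Suc i < k \<longrightarrow> z (Suc i) \<le> z i))"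
proof (induction k arbitrary: l)
  case (Suc k)
  have "rev (map z [0..<Suc k]) = z k # rev (map z [0..<k])" by simp
  then have "sorted (l # rev (map z [0..<Suc k]) @ [r]) \<longleftrightarrow>
      l \<le> z k \<and> sorted (z k # rev (map z [0..<k]) @ [r])"
    by (simp only: append_Cons sorted2)
  also have "\<dots> \<longleftrightarrow> l \<le> z k \<and> z 0 \<le> r \<and> (\<forall>i. Suc i < Suc k \<longrightarrow> z (Suc i) \<le> z i)"
    unfolding Suc.IH by (cases k) (auto simp: less_Suc_eq)
  finally show ?case by simp
qed auto

text \<open>The exponents of consecutive siblings differ by one, so clearing denominators turns the
  sorted chain into steps of ratio at most \<open>r\<close>. The lower bound on the leftmost child,
  which has the largest exponent, passes along the chain to its siblings.\<close>

lemma sorted_block_iff: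
  fixes y :: "nat \<Rightarrow> real"
  assumes r: "1 \<le> r"
  shows "sorted (1 # map (\<lambda>(i, e). y i / r ^ e) (rev (map (\<lambda>i. (p + i, s + i)) [0..<k])) @ [r]) \<longleftrightarrow>
    (\<forall>i<k. r ^ (s + i) \<le> y (p + i)) \<and> (0 < k \<longrightarrow> y p \<le> r ^ Suc s) \<and>
    (\<forall>i. Suc i < k \<longrightarrow> y (p + Suc i) \<le> r * y (p + i))"
proof -
  define z where "z i = y (p + i) / r ^ (s + i)" for i
  have pos: "0 < r ^ e" for e using r by simp
  have map: "map (\<lambda>(i, e). y i / r ^ e) (rev (map (\<lambda>i. (p + i, s + i)) [0..<k])) = rev (map z [0..<k])"
    by (simp add: rev_map z_def)
  have z1: "1 \<le> z i \<longleftrightarrow> r ^ (s + i) \<le> y (p + i)" for i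
    using pos[of "s + i"] by (simp add: z_def le_divide_eq)
  have z0: "z 0 \<le> r \<longleftrightarrow> y p \<le> r ^ Suc s"
    using pos[of s] by (simp add: z_def divide_le_eq)
  have zS: "z (Suc i) \<le> z i \<longleftrightarrow> y (p + Suc i) \<le> r * y (p + i)" for i
    using pos[of "s + i"] r by (simp add: z_def field_simps)
  have dec: "1 \<le> z i" if "\<forall>i. Suc i < k \<longrightarrow> z (Suc i) \<le> z i" "1 \<le> z (k - 1)" "i < k" for i
  proof -
    have "i \<le> k - 1" using that(3) by simp
    then have "z (k - 1) \<le> z i"
      using that(1) by (induction rule: inc_induct) (auto intro: order_trans)
    then show ?thesis using that(2) by simp
  qed
  show ?thesis
    unfolding map sorted_rev_map_upt z1[symmetric] z0[symmetric] zS[symmetric]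
    using r dec by auto
qed

text \<open>Membership in a tree polytope, extended to a stack of trees with next position
  \<open>p\<close> so that it can be unfolded one active node at a time; \<open>r\<close> stands for
  \<open>1 + t\<close>.\<close>

definition fits :: "real \<Rightarrow> (nat \<Rightarrow> real) \<Rightarrow> nat \<Rightarrow> plane_tree list \<Rightarrow> bool" where
  "fits r y p Ts \<longleftrightarrow> (\<forall>b\<in>set (blocks p Ts). sorted (1 # map (\<lambda>(i, e). y i / r ^ e) b @ [r]))"

lemma fits_Nil [simp]: "fits r y p []"
  by (simp add: fits_def)

lemma fits_Node:
  assumes "1 \<le> r"
  shows "fits r y p (Node ts # st) \<longleftrightarrow>
    (\<forall>i<length ts. r ^ (length st + i) \<le> y (p + i)) \<and>
    (0 < length ts \<longrightarrow> y p \<le> r ^ Suc (length st)) \<and>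
    (\<forall>i. Suc i < length ts \<longrightarrow> y (p + Suc i) \<le> r * y (p + i)) \<and>
    fits r y (p + length ts) (ts @ st)"
  unfolding fits_def blocks.simps list.set ball_simps sorted_block_iff[OF assms] by blast

text \<open>These are the inequalities of the Cayley polytope, shifted to start at position
  \<open>p\<close>. The bound \<open>r ^ length Ts\<close> on the first coordinate links consecutive
  blocks in the induction.\<close>

lemma
  assumes r: "1 \<le> r" and "fits r y p Ts"
  defines "q \<equiv> p + (num_nodes Ts - length Ts)"
  shows fits_first: "p < q \<Longrightarrow> y p \<le> r ^ length Ts"
    and fits_lower: "p \<le> i \<Longrightarrow> i < q \<Longrightarrow> 1 \<le> y i"
    and fits_step: "p \<le> i \<Longrightarrow> Suc i < q \<Longrightarrow> y (Suc i) \<le> r * y i"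
proof -
  have "(p < q \<longrightarrow> y p \<le> r ^ length Ts) \<and> (\<forall>i. p \<le> i \<and> i < q \<longrightarrow> 1 \<le> y i) \<and>
    (\<forall>i. p \<le> i \<and> Suc i < q \<longrightarrow> y (Suc i) \<le> r * y i)"
    using assms(2) unfolding q_def
  proof (induction Ts arbitrary: p rule: forest_induct)
    case (Node ts st)
    let ?k = "length ts" and ?s = "length st"
    let ?q = "p + (num_nodes (Node ts # st) - length (Node ts # st))"
    have q: "p + ?k + (num_nodes (ts @ st) - length (ts @ st)) = ?q"
      using length_le_num_nodes[of "ts @ st"] by simp
    have block: "\<And>i. i < ?k \<Longrightarrow> r ^ (?s + i) \<le> y (p + i)" "0 < ?k \<Longrightarrow> y p \<le> r ^ Suc ?s"
      "\<And>i. Suc i < ?k \<Longrightarrow> y (p + Suc i) \<le> r * y (p + i)"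
      and rest: "fits r y (p + ?k) (ts @ st)"
      using Node.prems fits_Node[OF r] by auto
    have IH: "p + ?k < ?q \<Longrightarrow> y (p + ?k) \<le> r ^ (?k + ?s)"
      "\<And>i. p + ?k \<le> i \<Longrightarrow> i < ?q \<Longrightarrow> 1 \<le> y i"
      "\<And>i. p + ?k \<le> i \<Longrightarrow> Suc i < ?q \<Longrightarrow> y (Suc i) \<le> r * y i"
      using Node.IH[OF rest] unfolding q by auto
    have "y p \<le> r ^ Suc ?s" if "p < ?q"
    proof (cases "?k = 0")
      case True
      then have "y p \<le> r ^ ?s" using IH(1) that by simp
      also have "\<dots> \<le> r ^ Suc ?s" using r by (intro power_increasing) auto
      finally show ?thesis .
    qed (use block in simp)
    moreover have "1 \<le> y i" if "p \<le> i" "i < ?q" for i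
    proof (cases "i < p + ?k")
      case True
      have "1 \<le> r ^ (?s + (i - p))" using r by simp
      also have "\<dots> \<le> y i" using block(1)[of "i - p"] that True by simp
      finally show ?thesis .
    qed (use IH that in simp)
    moreover have "y (Suc i) \<le> r * y i" if "p \<le> i" "Suc i < ?q" for i
    proof -
      consider "Suc i < p + ?k" | "Suc i = p + ?k" | "p + ?k \<le> i" by linarith
      then show ?thesis
      proof cases
        case 1
        then show ?thesis using block(3)[of "i - p"] that by simp
      next
        case 2
        then obtain j where j: "?k = Suc j" "i = p + j"
          using \<open>p \<le> i\<close> by (cases ?k) auto
        \<comment> \<open>At a block boundary there is no sibling inequality. The upper bound on the
          next coordinate is \<open>r\<close> times the lower bound on the last coordinate of this
          block.\<close>
        have "y (Suc i) \<le> r * r ^ (?s + j)"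
          using IH(1) 2 that(2) j by (simp add: add.commute)
        also have "\<dots> \<le> r * y i"
          using block(1)[of j] j r by (intro mult_left_mono) auto
        finally show ?thesis .
      qed (use IH that in simp)
    qed
    ultimately show ?case by simp
  qed simp
  then show "p < q \<Longrightarrow> y p \<le> r ^ length Ts"
    and "p \<le> i \<Longrightarrow> i < q \<Longrightarrow> 1 \<le> y i"
    and "p \<le> i \<Longrightarrow> Suc i < q \<Longrightarrow> y (Suc i) \<le> r * y i"
    by blast+
qed

text \<open>The greedy construction. The induction measure \<open>q - p + s\<close> counts the nodes
  that have not yet been active.\<close>

lemma ex_fits:
  assumes r: "1 \<le> r" and "p \<le> q" and "s = 0 \<Longrightarrow> p = q"
    and "p < q \<Longrightarrow> y p \<le> r ^ s"
    and "\<And>i. p \<le> i \<Longrightarrow> i < q \<Longrightarrow> 1 \<le> y i"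
    and "\<And>i. p \<le> i \<Longrightarrow> Suc i < q \<Longrightarrow> y (Suc i) \<le> r * y i"
  shows "\<exists>Ts. length Ts = s \<and> num_nodes Ts = s + (q - p) \<and> fits r y p Ts"
  using assms(2-)
proof (induction "q - p + s" arbitrary: p s rule: less_induct)
  case less
  show ?case
  proof (cases s)
    case 0
    then show ?thesis
      using less.prems by (intro exI[of _ "[]"]) simp
  next
    case (Suc s')
    \<comment> \<open>Before the stop the failed test gives the lower bounds for the children; at
      the stop, if a coordinate is left, it gives the upper bound for the recursive call.\<close>
    let ?stop = "\<lambda>k. \<not> (p + k < q \<and> r ^ (s' + k) \<le> y (p + k))"
    define k where "k = (LEAST k. ?stop k)"
    have "?stop (q - p)"
      using less.prems(1) by simp
    then have stop: "?stop k" and "k \<le> q - p"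
      unfolding k_def by (rule LeastI[of ?stop], rule Least_le[of ?stop])
    have below: "p + i < q" "r ^ (s' + i) \<le> y (p + i)" if "i < k" for i
      using not_less_Least[of i ?stop] that unfolding k_def by auto
    have "\<exists>Ts. length Ts = s' + k \<and> num_nodes Ts = s' + k + (q - (p + k)) \<and> fits r y (p + k) Ts"
    proof (rule less.hyps)
      show "q - (p + k) + (s' + k) < q - p + s"
        using \<open>k \<le> q - p\<close> less.prems(1) Suc by simp
      show "p + k \<le> q"
        using \<open>k \<le> q - p\<close> less.prems(1) by simp
      \<comment> \<open>With an empty stack and a coordinate left, the stopping rule would say
        \<open>y p < 1\<close>.\<close>
      show "p + k = q" if "s' + k = 0"
        using that stop less.prems(1) less.prems(4)[of p] by force
      show "y (p + k) \<le> r ^ (s' + k)" if "p + k < q"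
        using that stop by simp
    qed (use less.prems in auto)
    then obtain Us where Us: "length Us = s' + k" "num_nodes Us = s' + k + (q - (p + k))"
        "fits r y (p + k) Us"
      by blast
    let ?Ts = "Node (take k Us) # drop k Us"
    have "fits r y p ?Ts"
      unfolding fits_Node[OF r] using below less.prems(3,5) Us(1,3) Suc
      by (auto simp: below(1) dest: below(1))
    moreover have "num_nodes ?Ts = s + (q - p)"
      using Us(2) Suc \<open>k \<le> q - p\<close> by simp
    ultimately show ?thesis
      using Us(1) Suc by (intro exI[of _ ?Ts]) simp
  qed
qed

text \<open>
  If the second tree gives its first node more children, the coordinate following those of the
  first is bounded by the same power of \<open>r\<close> from both sides.
\<close>

lemma fits_same_degree:
  assumes r: "1 \<le> r" and "fits r y p (Node ts # st)" and "fits r y p (Node us # su)"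
    and len: "length st = length su" and nodes: "num_nodes (ts @ st) = num_nodes (us @ su)"
    and generic: "\<And>i e. p \<le> i \<Longrightarrow> i < p + (num_nodes (ts @ st) - length st) \<Longrightarrow> y i \<noteq> r ^ e"
  shows "length us \<le> length ts"
proof (rule ccontr)
  let ?k = "length ts" and ?s = "length st"
  assume less: "\<not> length us \<le> length ts"
  have "r ^ (?s + ?k) \<le> y (p + ?k)"
    using assms(3) less len fits_Node[OF r] by simp
  moreover have pos: "?k + ?s < num_nodes (ts @ st)"
    using length_le_num_nodes[of "us @ su"] nodes less len by simp
  then have "y (p + ?k) \<le> r ^ length (ts @ st)"
    using assms(2) fits_Node[OF r] by (intro fits_first[OF r]) auto
  ultimately have "y (p + ?k) = r ^ (?s + ?k)"
    by (simp add: add.commute)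
  moreover have "p + ?k < p + (num_nodes (ts @ st) - ?s)"
    using pos by simp
  ultimately show False
    using generic[of "p + ?k"] by simp
qed

text \<open>Using \<open>fits_same_degree\<close> in both directions makes the first degrees equal.
  The excluded values \<open>r ^ e\<close> are where the greedy rule can tie.\<close>

lemma fits_unique:
  assumes r: "1 \<le> r" and "fits r y p Ts" and "fits r y p Us"
    and "length Ts = length Us" and "num_nodes Ts = num_nodes Us"
    and "\<And>i e. p \<le> i \<Longrightarrow> i < p + (num_nodes Ts - length Ts) \<Longrightarrow> y i \<noteq> r ^ e"
  shows "Ts = Us"
  using assms(2-)
proof (induction Ts arbitrary: p Us rule: forest_induct)
  case (Node ts st)
  obtain us su where Us: "Us = Node us # su"
    using Node.prems(3) by (metis length_0_conv list.distinct(1) list.exhaust plane_tree.exhaust)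
  have len: "length st = length su" and nodes: "num_nodes (ts @ st) = num_nodes (us @ su)"
    using Node.prems Us by auto
  have generic: "y i \<noteq> r ^ e" if "p \<le> i" "i < p + (num_nodes (ts @ st) - length st)" for i e
    using Node.prems(5)[of i e] that by simp
  have "length us \<le> length ts"
    using fits_same_degree[OF r Node.prems(1) Node.prems(2)[unfolded Us] len nodes generic] .
  moreover have "length ts \<le> length us"
    using fits_same_degree[OF r Node.prems(2)[unfolded Us] Node.prems(1) len[symmetric] nodes[symmetric]]
      generic len nodes by simp
  ultimately have k: "length ts = length us" by simp
  have "ts @ st = us @ su"
  proof (rule Node.IH)
    show "fits r y (p + length ts) (ts @ st)" "fits r y (p + length ts) (us @ su)"
      using Node.prems(1,2) Us k fits_Node[OF r] by auto
    show "y i \<noteq> r ^ e"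
      if "p + length ts \<le> i" "i < p + length ts + (num_nodes (ts @ st) - length (ts @ st))" for i e
      using that length_le_num_nodes[of "ts @ st"] by (intro generic) auto
  qed (use k len nodes in auto)
  then show ?case
    using Us k by simp
qed simp

section \<open>The volume of block regions\<close>

text \<open>The library's \<open>measure_orthogonal_image\<close> requires a well-ordered index type.\<close>

lemma measure_permute_coordinates:
  fixes p :: "'n::finite \<Rightarrow> 'n" and S :: "(real^'n) set"
  assumes p: "p permutes UNIV" and S: "S \<in> lmeasurable"
  shows "measure lebesgue ((\<lambda>x. \<chi> i. x $ p i) ` S) = measure lebesgue S"
proof -
  let ?f = "\<lambda>x::real^'n. \<chi> i. x $ p i"
  have "linear ?f"
    by (rule linearI) (auto simp: vec_eq_iff)
  have image: "?f ` cbox a b = cbox (?f a) (?f b)" for a b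
  proof
    show "?f ` cbox a b \<subseteq> cbox (?f a) (?f b)"
      by (auto simp: mem_box_cart)
    show "cbox (?f a) (?f b) \<subseteq> ?f ` cbox a b"
    proof
      fix y assume y: "y \<in> cbox (?f a) (?f b)"
      let ?x = "\<chi> i. y $ inv p i"
      have "a $ i \<le> ?x $ i \<and> ?x $ i \<le> b $ i" for i
        using y permutes_inverses(1)[OF p, of i] unfolding mem_box_cart by (metis vec_lambda_beta)
      then have "?x \<in> cbox a b"
        by (simp add: mem_box_cart)
      moreover have "?f ?x = y"
        using permutes_inverses(2)[OF p] by (simp add: vec_eq_iff)
      ultimately show "y \<in> ?f ` cbox a b"
        by (metis imageI)
    qed
  qed
  \<comment> \<open>For a linear map it suffices to compare the volumes of boxes, and here the side
    lengths are merely permuted.\<close>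
  have "measure lebesgue (?f ` cbox a b) = 1 * measure lebesgue (cbox a b)" for a b
  proof (cases "cbox a b = {}")
    case False
    then have "cbox (?f a) (?f b) \<noteq> {}"
      using image by blast
    then show ?thesis
      using False prod.permute[OF p, of "\<lambda>i. b $ i - a $ i"]
      by (simp add: image content_cbox_cart o_def)
  qed simp
  then show ?thesis
    using measure_linear_sufficient[OF \<open>linear ?f\<close> S, of 1] by simp
qed

lemma ex_permutation_map:
  assumes "distinct xs" and "distinct ys" and "set xs = set ys"
  obtains p where "p permutes set xs" and "map p xs = ys"
proof -
  have len: "length xs = length ys"
    using assms distinct_card by metis
  define p where "p x = (case map_of (zip xs ys) x of None \<Rightarrow> x | Some y \<Rightarrow> y)" for x
  have map: "map p xs = ys"
    using len assms(1) by (intro nth_equalityI) (auto simp: p_def map_of_zip_nth)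
  have "p permutes set xs"
  proof (rule bij_imp_permutes)
    show "bij_betw p (set xs) (set xs)"
      using map assms by (metis bij_betw_def distinct_map list.set_map)
    show "p x = x" if "x \<notin> set xs" for x
      using that len by (simp add: p_def split: option.split)  (metis in_set_zipE map_of_SomeD)
  qed
  then show thesis using map that by blast
qed

lemma map_vec_nth_vec_lambda: "map (($) (vec_lambda f)) is = map f is"
  by simp

lemma closed_sorted_coordinates: "closed {x::real^'n. sorted (map (\<lambda>i. x $ p i) is)}"
proof -
  have "{x::real^'n. sorted (map (\<lambda>i. x $ p i) is)} =
      (\<Inter>j\<in>{..<length is}. \<Inter>i\<in>{..j}. {x. x $ p (is ! i) \<le> x $ p (is ! j)})"
    by (auto simp: sorted_iff_nth_mono) 
  moreover have "closed {x::real^'n. x $ a \<le> x $ b}" for a b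
    by (intro closed_Collect_le continuous_intros)
  ultimately show ?thesis
    by (simp add: closed_INT)
qed

text \<open>The regions \<open>S' p\<close>, one for each permutation \<open>p\<close> of
  \<open>is\<close>, cover \<open>Q\<close>, have equal measure because \<open>Q\<close> is
  invariant, and overlap only in hyperplanes. There are \<open>fact (length is)\<close> of
  them.\<close>

lemma measure_sorted_coordinates:
  fixes Q :: "(real^'n) set"
  assumes Q: "Q \<in> lmeasurable" and dist: "distinct is"
    and inv: "\<And>p x. p permutes set is \<Longrightarrow> x \<in> Q \<Longrightarrow> (\<chi> i. x $ p i) \<in> Q"
  defines "S \<equiv> {x \<in> Q. sorted (map (($) x) is)}"
  shows "S \<in> lmeasurable" and "measure lebesgue S * fact (length is) = measure lebesgue Q"
proof -
  define S' where "S' p = {x \<in> Q. sorted (map (\<lambda>i. x $ p i) is)}" for p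
  have lm: "S' p \<in> lmeasurable" for p
  proof -
    have "S' p = Q \<inter> {x. sorted (map (\<lambda>i. x $ p i) is)}"
      by (auto simp: S'_def)
    moreover have "{x::real^'n. sorted (map (\<lambda>i. x $ p i) is)} \<in> sets lebesgue"
      using borel_closed[OF closed_sorted_coordinates[of p "is"]] by (simp add: sets_completionI_sets)
    ultimately show ?thesis
      using Q by (simp only: fmeasurable_Int_fmeasurable)
  qed
  have S_id: "S = S' (\<lambda>i. i)" by (simp add: S_def S'_def)
  show "S \<in> lmeasurable"
    using lm unfolding S_id .
  have same: "measure lebesgue (S' p) = measure lebesgue S" if p: "p permutes set is" for p
  proof -
    let ?f = "\<lambda>x::real^'n. \<chi> i. x $ p i"
    have "?f ` S' p = S"
    proof
      show "?f ` S' p \<subseteq> S"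
        using inv[OF p] by (auto simp: S'_def S_def map_vec_nth_vec_lambda)
      show "S \<subseteq> ?f ` S' p"
      proof
        fix y assume y: "y \<in> S"
        let ?x = "\<chi> i. y $ inv p i"
        have "?x \<in> Q"
          using y inv[OF permutes_inv[OF p]] by (auto simp: S_def)
        moreover have "?f ?x = y"
          using permutes_inverses(2)[OF p] by (simp add: vec_eq_iff)
        moreover have eq: "map (\<lambda>i. ?x $ p i) is = map (($) y) is"
          using permutes_inverses(2)[OF p] by simp
        have "sorted (map (\<lambda>i. ?x $ p i) is)"
          unfolding eq using y by (simp add: S_def)
        ultimately show "y \<in> ?f ` S' p"
          unfolding S'_def by (intro image_eqI[of _ _ ?x]) auto
      qed
    qed
    moreover have "measure lebesgue (?f ` S' p) = measure lebesgue (S' p)"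
      using p lm permutes_subset by (intro measure_permute_coordinates) blast+
    ultimately show ?thesis
      by simp
  qed
  have cover: "(\<Union>p\<in>{p. p permutes set is}. S' p) = Q"
  proof
    show "Q \<subseteq> (\<Union>p\<in>{p. p permutes set is}. S' p)"
    proof
      fix x assume x: "x \<in> Q"
      obtain p where p: "p permutes set is" "map p is = sort_key (($) x) is"
        using ex_permutation_map[of "is" "sort_key (($) x) is"] dist by auto
      have "map (\<lambda>i. x $ p i) is = map (($) x) (map p is)" by simp
      then have "sorted (map (\<lambda>i. x $ p i) is)"
        using p(2) by (metis sorted_sort_key)
      then show "x \<in> (\<Union>p\<in>{p. p permutes set is}. S' p)"
        using x p(1) by (auto simp: S'_def)
    qed
  qed (auto simp: S'_def)
  have negl: "negligible (S' p \<inter> S' q)" if pq: "p permutes set is" "q permutes set is" "p \<noteq> q" for p q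
  proof -
    obtain i where i: "p i \<noteq> q i" using pq(3) by blast
    then have "i \<in> set is"
      using pq(1,2) by (metis permutes_not_in)
    \<comment> \<open>On an overlap both rearrangements are the sorted list of the same multiset,
      hence agree entry by entry.\<close>
    have "x $ p i = x $ q i" if x: "x \<in> S' p \<inter> S' q" for x
    proof -
      have perm: "mset (map (\<lambda>i. x $ p i) is) = image_mset (($) x) (mset is)" if "p permutes set is" for p
      proof -
        have "image_mset p (mset_set (set is)) = mset_set (set is)"
          by (rule permutes_image_mset[OF that])
        then have "image_mset (($) x) (image_mset p (mset is)) = image_mset (($) x) (mset is)"
          using dist by (simp add: mset_set_set)
        then show ?thesis
          by (simp add: multiset.map_comp o_def)
      qed
      have "sort (map (\<lambda>i. x $ q i) is) = map (\<lambda>i. x $ p i) is"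
        using x perm[OF pq(1)] perm[OF pq(2)] by (intro properties_for_sort) (auto simp: S'_def)
      moreover have "sort (map (\<lambda>i. x $ q i) is) = map (\<lambda>i. x $ q i) is"
        using x by (intro sorted_sort_id) (simp add: S'_def)
      ultimately have "map (\<lambda>i. x $ p i) is = map (\<lambda>i. x $ q i) is"
        by simp
      then show ?thesis
        using \<open>i \<in> set is\<close> by simp
    qed
    then have "S' p \<inter> S' q \<subseteq> {x. (axis (p i) 1 - axis (q i) 1) \<bullet> x = 0}"
      by (auto simp: inner_diff_left inner_axis' )
    moreover have "axis (p i) (1::real) - axis (q i) 1 \<noteq> 0"
      using i by (simp add: axis_eq_axis)
    ultimately show ?thesis
      using negligible_hyperplane negligible_subset by blast
  qed
  have "measure lebesgue Q = (\<Sum>p | p permutes set is. measure lebesgue (S' p))"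
    unfolding cover[symmetric]
    by (rule measure_negligible_finite_Union_image)
      (use lm negl in \<open>auto simp: pairwise_def finite_permutations\<close>)
  also have "\<dots> = fact (length is) * measure lebesgue S"
    using dist by (simp add: same card_permutations distinct_card)
  finally show "measure lebesgue S * fact (length is) = measure lebesgue Q"
    by simp
qed

text \<open>The blocks are sorted one at a time: permuting the coordinates of \<open>b\<close> does
  not touch the other blocks, so the region cut out by them is still invariant.\<close>

lemma measure_sorted_blocks:
  fixes Q :: "(real^'n) set"
  assumes Q: "Q \<in> lmeasurable" and "distinct (concat bs)"
    and inv: "\<And>p x. p permutes UNIV \<Longrightarrow> x \<in> Q \<Longrightarrow> (\<chi> i. x $ p i) \<in> Q"
  shows "{x \<in> Q. \<forall>b\<in>set bs. sorted (map (($) x) b)} \<in> lmeasurable \<and>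
    measure lebesgue {x \<in> Q. \<forall>b\<in>set bs. sorted (map (($) x) b)}
      * prod_list (map (\<lambda>b. fact (length b)) bs) = measure lebesgue Q"
  using assms(2)
proof (induction bs)
  case (Cons b bs)
  let ?R = "{x \<in> Q. \<forall>b\<in>set bs. sorted (map (($) x) b)}"
  have IH: "?R \<in> lmeasurable"
    "measure lebesgue ?R * prod_list (map (\<lambda>b. fact (length b)) bs) = measure lebesgue Q"
    using Cons by auto
  have "(\<chi> i. x $ p i) \<in> ?R" if p: "p permutes set b" and x: "x \<in> ?R" for p x
  proof -
    have eq: "map (($) (\<chi> i. x $ p i)) b' = map (($) x) b'" if "b' \<in> set bs" for b'
      using that Cons.prems permutes_not_in[OF p] by fastforce
    have "sorted (map (($) (\<chi> i. x $ p i)) b')" if "b' \<in> set bs" for b'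
      unfolding eq[OF that] using that x by simp
    moreover have "p permutes UNIV"
      using p permutes_subset by blast
    ultimately show ?thesis
      using x inv by blast
  qed
  moreover have "{x \<in> Q. \<forall>b\<in>set (b # bs). sorted (map (($) x) b)} = {x \<in> ?R. sorted (map (($) x) b)}"
    by auto
  ultimately show ?case
    using measure_sorted_coordinates[OF IH(1), of b] IH(2) Cons.prems by (simp add: mult.assoc[symmetric])
qed (use Q in simp)

text \<open>Stretching coordinate \<open>i\<close> by \<open>r i\<close> maps the block-sorted part
  of the cube \<open>?Q\<close> onto \<open>D\<close>, with determinant
  \<open>prod r UNIV\<close>.\<close>

lemma measure_block_region:
  fixes r :: "'n::finite \<Rightarrow> real"
  assumes "distinct (concat bs)" and "set (concat bs) = UNIV" and r: "\<And>i. 0 < r i" and t: "0 \<le> t"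
  defines "D \<equiv> {x::real^'n. \<forall>b\<in>set bs. sorted (1 # map (\<lambda>i. x $ i / r i) b @ [1 + t])}"
  shows "measure lebesgue D * prod_list (map (\<lambda>b. fact (length b)) bs) = prod r UNIV * t ^ CARD('n)"
proof -
  let ?Q = "cbox (\<chi> i. 1) (\<chi> i. 1 + t) :: (real^'n) set"
  let ?S = "{x \<in> ?Q. \<forall>b\<in>set bs. sorted (map (($) x) b)}"
  have "?Q \<noteq> {}"
    using t by (simp add: interval_ne_empty_cart)
  then have Q: "measure lebesgue ?Q = t ^ CARD('n)"
    by (simp add: content_cbox_cart)
  have S: "?S \<in> lmeasurable"
    "measure lebesgue ?S * prod_list (map (\<lambda>b. fact (length b)) bs) = measure lebesgue ?Q"
    using measure_sorted_blocks[of ?Q bs] assms(1) by (auto simp: mem_box_cart)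
  have sorted_iff: "sorted (1 # map f b @ [1 + t]) \<longleftrightarrow> sorted (map f b) \<and> (\<forall>i\<in>set b. 1 \<le> f i \<and> f i \<le> 1 + t)"
    for f :: "'n \<Rightarrow> real" and b
    using t by (auto simp: sorted_append)
  have mem_D: "x \<in> D \<longleftrightarrow> (\<chi> i. x $ i / r i) \<in> ?S" for x
  proof -
    have all: "(\<forall>i. P i) \<longleftrightarrow> (\<forall>b\<in>set bs. \<forall>i\<in>set b. P i)" for P
      using assms(2) by (metis UNIV_I UN_E set_concat)
    show ?thesis
      unfolding D_def mem_Collect_eq sorted_iff ball_conj_distrib mem_box_cart map_vec_nth_vec_lambda
      by (auto simp: all[where P = "\<lambda>i. 1 \<le> x $ i / r i \<and> x $ i / r i \<le> 1 + t"])
  qed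
  have "D = (\<lambda>x. \<chi> i. r i * x $ i) ` ?S"
  proof
    show "D \<subseteq> (\<lambda>x. \<chi> i. r i * x $ i) ` ?S"
    proof
      fix x assume "x \<in> D"
      then show "x \<in> (\<lambda>x. \<chi> i. r i * x $ i) ` ?S"
        using mem_D[of x] r
        by (intro image_eqI[of _ _ "\<chi> i. x $ i / r i"]) (auto simp: vec_eq_iff less_imp_neq[THEN not_sym])
    qed
    show "(\<lambda>x. \<chi> i. r i * x $ i) ` ?S \<subseteq> D"
    proof
      fix x assume "x \<in> (\<lambda>x. \<chi> i. r i * x $ i) ` ?S"
      then obtain y where y: "y \<in> ?S" "x = (\<chi> i. r i * y $ i)" by blast
      have "(\<chi> i. x $ i / r i) = y"
        using r y(2) by (auto simp: vec_eq_iff less_imp_neq[THEN not_sym])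
      then show "x \<in> D"
        using y(1) mem_D by simp
    qed
  qed
  then have "measure lebesgue D = \<bar>prod r UNIV\<bar> * measure lebesgue ?S"
    using measure_stretch[OF S(1)] by simp
  also have "\<bar>prod r UNIV\<bar> = prod r UNIV"
    using r by (simp add: prod_nonneg less_imp_le)
  finally show ?thesis
    using S(2) Q by (simp add: mult.assoc)
qed

text \<open>A pair \<open>(a, c)\<close> encodes an affine function, and each comparison of two such
  functions is a halfspace.\<close>

lemma polyhedron_sorted:
  fixes fs :: "('a::euclidean_space \<times> real) list"
  shows "polyhedron {x. sorted (map (\<lambda>(a, c). a \<bullet> x + c) fs)}"
proof (induction fs)
  case (Cons f fs)
  let ?H = "\<lambda>g. {x. (fst f - fst g) \<bullet> x \<le> snd g - snd f}"
  have "{x. sorted (map (\<lambda>(a, c). a \<bullet> x + c) (f # fs))}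
      = \<Inter>(?H ` set fs) \<inter> {x. sorted (map (\<lambda>(a, c). a \<bullet> x + c) fs)}"
    by (auto simp: inner_diff_left algebra_simps split_beta)
  moreover have "polyhedron (\<Inter>(?H ` set fs))"
    by (rule polyhedron_Inter) (auto intro: polyhedron_halfspace_le)
  ultimately show ?case
    using Cons by (simp add: polyhedron_Int)
qed simp

lemma polytope_block_region:
  fixes r :: "'n::finite \<Rightarrow> real" and t :: real
  assumes "set (concat bs) = UNIV" and r: "\<And>i. 0 < r i"
  defines "D \<equiv> {x::real^'n. \<forall>b\<in>set bs. sorted (1 # map (\<lambda>i. x $ i / r i) b @ [1 + t])}"
  shows "polytope D"
proof -
  \<comment> \<open>The bounds 1 and \<open>1 + t\<close> enter as affine functions with zero linear
    part.\<close>
  let ?fs = "\<lambda>b. (0, 1) # map (\<lambda>i. (axis i (1 / r i), 0)) b @ [(0, 1 + t)]"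
  have "D = \<Inter>((\<lambda>b. {x. sorted (map (\<lambda>(a, c). a \<bullet> x + c) (?fs b))}) ` set bs)"
    by (auto simp: D_def inner_axis' o_def)
  then have "polyhedron D"
    using polyhedron_sorted by (auto simp del: sorted_simps list.map)
  moreover have "D \<subseteq> cbox (\<chi> i. r i) (\<chi> i. (1 + t) * r i)"
  proof
    fix x assume x: "x \<in> D"
    have "r i \<le> x $ i \<and> x $ i \<le> (1 + t) * r i" for i
    proof -
      obtain b where "b \<in> set bs" "i \<in> set b"
        using assms(1) by (metis UNIV_I set_concat UN_E)
      then have "1 \<le> x $ i / r i \<and> x $ i / r i \<le> 1 + t"
        using x by (auto simp: D_def sorted_append)
      then show ?thesis
        using r[of i] by (simp add: field_simps)
    qed
    then show "x \<in> cbox (\<chi> i. r i) (\<chi> i. (1 + t) * r i)"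
      by (simp add: mem_box_cart)
  qed
  ultimately show ?thesis
    using bounded_subset[OF bounded_cbox] polytope_eq_bounded_polyhedron by blast
qed

section \<open>The subdivision of the Cayley polytope\<close>

lemma mset_concat_map_rev: "mset (concat (map rev xss)) = mset (concat xss)"
  by (induction xss) auto

lemma prod_list_power:
  fixes a :: "'a::comm_monoid_mult"
  shows "prod_list (map (\<lambda>x. a ^ f x) xs) = a ^ sum_list (map f xs)"
  by (induction xs) (simp_all add: power_add)

lemma mem_tree_polytope: "x \<in> tree_polytope c t T \<longleftrightarrow> fits (1 + t) (\<lambda>i. x $ c i) 1 [T]"
  unfolding tree_polytope_def fits_def blocks_plane_tree by (simp add: o_def)

text \<open>The positions of the nodes other than the root are \<open>1, ..., n\<close>, each taken
  once, so \<open>c\<close> turns the sibling blocks into a partition of the coordinates.\<close>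

lemma tree_polytope_eq_block_region:
  fixes c :: "nat \<Rightarrow> 'n::finite" and t :: real
  assumes T: "T \<in> plane_trees (n + 1)" and c: "bij_betw c {1..n} UNIV" and t: "0 < t"
  obtains bs and r :: "'n \<Rightarrow> real"
  where "tree_polytope c t T =
      {x. \<forall>b\<in>set bs. sorted (1 # map (\<lambda>i. x $ i / r i) b @ [1 + t])}"
    and "distinct (concat bs)" and "set (concat bs) = UNIV" and "\<And>i. 0 < r i"
    and "prod r UNIV = (1 + t) ^ stack_weight [T]"
    and "map length bs = degree_seq T"
proof
  let ?B = "blocks 1 [T]"
  let ?P = "concat ?B"
  \<comment> \<open>The exponent is the cane count of the node whose NFS position is the number of
    the coordinate \<open>i\<close>.\<close>
  define r where "r i = (1 + t) ^ the (map_of ?P (inv_into {1..n} c i))" for i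
  let ?bs = "map (map (\<lambda>(j, e). c j)) ?B"
  have "mset (map fst ?P) = mset (map fst (concat (map rev ?B)))"
    by (simp only: mset_map mset_concat_map_rev)
  also have "\<dots> = mset [1..<n + 1]"
    using T by (simp only: positions_blocks) (simp add: mem_plane_trees_iff del: num_nodes_simps)
  finally have pos: "mset (map fst ?P) = mset [1..<n + 1]" .
  then have dist: "distinct (map fst ?P)"
    using mset_eq_imp_distinct_iff distinct_upt by blast
  have "set (map fst ?P) = set [1..<n + 1]"
    using pos by (rule mset_eq_setD)
  then have set: "set (map fst ?P) = {1..n}" by auto
  have concat: "concat ?bs = map c (map fst ?P)"
    by (simp add: map_concat o_def case_prod_unfold)
  show "distinct (concat ?bs)"
    unfolding concat distinct_map set using dist c by (simp add: bij_betw_def distinct_map)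
  show "set (concat ?bs) = UNIV"
    unfolding concat set_map[of c] set using c by (simp add: bij_betw_def)
  have r_eq: "r (c j) = (1 + t) ^ e" if "(j, e) \<in> set ?P" for j e
  proof -
    have "j \<in> {1..n}"
      using set that by (force simp del: set_concat)
    then have "inv_into {1..n} c (c j) = j"
      using c by (simp add: bij_betw_inv_into_left)
    then show ?thesis
      using map_of_is_SomeI[OF dist that] by (simp add: r_def del: set_concat)
  qed
  have block: "map (\<lambda>i. x $ i / r i) (map (\<lambda>(j, e). c j) b) = map (\<lambda>(j, e). x $ c j / (1 + t) ^ e) b"
    if "b \<in> set ?B" for b and x :: "real^'n"
  proof -
    have "r (c j) = (1 + t) ^ e" if "(j, e) \<in> set b" for j e
      using that \<open>b \<in> set ?B\<close> by (intro r_eq) auto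
    then show ?thesis by auto
  qed
  show "tree_polytope c t T =
      {x. \<forall>b\<in>set ?bs. sorted (1 # map (\<lambda>i. x $ i / r i) b @ [1 + t])}"
    unfolding set_eq_iff mem_tree_polytope fits_def mem_Collect_eq set_map ball_simps
    using block by (auto simp del: blocks.simps map_map)
  show "0 < r i" for i
    using t by (simp add: r_def)
  have "prod r UNIV = prod_list (map r (concat ?bs))"
    using prod.distinct_set_conv_list[OF \<open>distinct (concat ?bs)\<close>, of r]
    unfolding \<open>set (concat ?bs) = UNIV\<close> .
  also have "map r (concat ?bs) = map (\<lambda>q. (1 + t) ^ snd q) ?P"
    unfolding concat map_map using r_eq by (auto simp del: set_concat)
  also have "prod_list \<dots> = (1 + t) ^ stack_weight [T]"
    using exponents_blocks[of 1 "[T]"] by (simp add: prod_list_power del: blocks.simps)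
  finally show "prod r UNIV = (1 + t) ^ stack_weight [T]" .
  show "map length ?bs = degree_seq T"
    using length_blocks[of 1 "[T]"] by (simp add: o_def del: blocks.simps)
qed

lemma
  fixes c :: "nat \<Rightarrow> 'n::finite" and t :: real
  assumes T: "T \<in> plane_trees (n + 1)" and c: "bij_betw c {1..n} UNIV" and t: "0 < t"
    and n: "n = CARD('n)"
  shows polytope_tree_polytope: "polytope (tree_polytope c t T)"
    and measure_tree_polytope: "measure lebesgue (tree_polytope c t T) * prod_list (map fact (degree_seq T))
           = t ^ n * (1 + t) ^ stack_weight [T]"
proof -
  obtain bs and r :: "'n \<Rightarrow> real" where D: "tree_polytope c t T =
      {x. \<forall>b\<in>set bs. sorted (1 # map (\<lambda>i. x $ i / r i) b @ [1 + t])}"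
    and bs: "distinct (concat bs)" "set (concat bs) = UNIV" and r: "\<And>i. 0 < r i"
    and prod: "prod r UNIV = (1 + t) ^ stack_weight [T]"
    and deg: "map length bs = degree_seq T"
    using tree_polytope_eq_block_region[OF T c t] by blast
  show "polytope (tree_polytope c t T)"
    unfolding D using polytope_block_region[OF bs(2) r] .
  show "measure lebesgue (tree_polytope c t T) * prod_list (map fact (degree_seq T))
           = t ^ n * (1 + t) ^ stack_weight [T]"
    using measure_block_region[OF bs r, of t] t prod n
    unfolding D deg[symmetric] by (simp add: o_def mult.commute)
qed

text \<open>By \<open>fits_unique\<close> a common point has some coordinate equal to a power of
  \<open>1 + t\<close>, which confines it to countably many hyperplanes.\<close>

lemma negligible_tree_polytope_Int:
  fixes c :: "nat \<Rightarrow> 'n::finite" and t :: real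
  assumes "T \<in> plane_trees m" and "U \<in> plane_trees m" and "T \<noteq> U" and t: "0 < t"
  shows "negligible (tree_polytope c t T \<inter> tree_polytope c t U)"
proof -
  let ?H = "\<lambda>(i, e). {x :: real^'n. axis i 1 \<bullet> x = (1 + t) ^ e}"
  have "\<exists>q :: 'n \<times> nat. x \<in> ?H q" if x: "x \<in> tree_polytope c t T \<inter> tree_polytope c t U" for x
  proof (rule ccontr)
    assume *: "\<nexists>q :: 'n \<times> nat. x \<in> ?H q"
    then have "x $ c i \<noteq> (1 + t) ^ e" for i e
      by (auto simp: inner_axis')
    then have "[T] = [U]"
      using x t assms(1,2)
      by (intro fits_unique[of "1 + t" "\<lambda>i. x $ c i" 1])
        (auto simp: mem_tree_polytope mem_plane_trees_iff simp del: num_nodes_simps)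
    then show False using assms(3) by simp
  qed
  then have "tree_polytope c t T \<inter> tree_polytope c t U \<subseteq> \<Union>(range ?H)"
    by blast
  moreover have "negligible (\<Union>(range ?H))"
    by (rule negligible_countable_Union) (auto intro!: negligible_hyperplane simp: axis_eq_0_iff)
  ultimately show ?thesis
    using negligible_subset by blast
qed

text \<open>One inclusion collects the bounds implied by \<open>fits\<close>; the other is the
  greedy construction, started at position 1 with a stack of height 1.\<close>

lemma Union_tree_polytope:
  fixes c :: "nat \<Rightarrow> 'n::finite" and t :: real
  assumes n: "n = CARD('n)" and t: "0 < t"
  shows "(\<Union>T\<in>plane_trees (n + 1). tree_polytope c t T) = cayley_polytope c t"
proof
  have r: "1 \<le> 1 + t" using t by simp
  have n1: "1 \<le> n" using n by (simp add: Suc_le_eq)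
  show "(\<Union>T\<in>plane_trees (n + 1). tree_polytope c t T) \<subseteq> cayley_polytope c t"
  proof
    fix x assume "x \<in> (\<Union>T\<in>plane_trees (n + 1). tree_polytope c t T)"
    then obtain T where T: "T \<in> plane_trees (n + 1)" and fits: "fits (1 + t) (\<lambda>i. x $ c i) 1 [T]"
      by (auto simp: mem_tree_polytope)
    have nodes: "num_nodes [T] - length [T] = n"
      using T by (simp add: mem_plane_trees_iff del: num_nodes_simps)
    have "x $ c 1 \<le> 1 + t"
      using fits_first[OF r fits] nodes n1 by (simp del: num_nodes_simps)
    moreover have "1 \<le> x $ c i" if "i \<in> {1..n}" for i
      using fits_lower[OF r fits, of i] nodes that by (simp del: num_nodes_simps)
    moreover have "x $ c i \<le> (1 + t) * x $ c (i - 1)" if "i \<in> {2..n}" for i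
    proof -
      obtain j where "i = Suc j" "1 \<le> j"
        using \<open>i \<in> {2..n}\<close> by (cases i) auto
      then show ?thesis
        using fits_step[OF r fits, of j] nodes that by (simp del: num_nodes_simps)
    qed
    ultimately show "x \<in> cayley_polytope c t"
      using n n1 by (auto simp: cayley_polytope_def)
  qed
  show "cayley_polytope c t \<subseteq> (\<Union>T\<in>plane_trees (n + 1). tree_polytope c t T)"
  proof
    fix x assume x: "x \<in> cayley_polytope c t"
    have "\<exists>Ts. length Ts = 1 \<and> num_nodes Ts = 1 + (n + 1 - 1) \<and> fits (1 + t) (\<lambda>i. x $ c i) 1 Ts"
    proof (rule ex_fits[OF r])
      show "1 \<le> x $ c i" if "1 \<le> i" "i < n + 1" for i
        using x that n by (cases "i = 1") (auto simp: cayley_polytope_def)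
      show "x $ c (Suc i) \<le> (1 + t) * x $ c i" if "1 \<le> i" "Suc i < n + 1" for i
      proof -
        have "Suc i \<in> {2..CARD('n)}" using that n by auto
        then show ?thesis
          using x unfolding cayley_polytope_def by fastforce
      qed
    qed (use x in \<open>auto simp: cayley_polytope_def\<close>)
    then obtain T where "num_nodes [T] = n + 1" "fits (1 + t) (\<lambda>i. x $ c i) 1 [T]"
      by (auto simp: length_Suc_conv simp del: num_nodes_simps)
    then show "x \<in> (\<Union>T\<in>plane_trees (n + 1). tree_polytope c t T)"
      by (auto simp: mem_tree_polytope mem_plane_trees_iff simp del: num_nodes_simps)
  qed
qed

lemma polyhedron_cayley_polytope:
  fixes c :: "nat \<Rightarrow> 'n::finite"
  shows "polyhedron (cayley_polytope c t)"
proof -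
  let ?S = "\<lambda>fs :: ((real^'n) \<times> real) list. {x. sorted (map (\<lambda>(a, c). a \<bullet> x + c) fs)}"
  have "x \<in> ?S [(0, 1), (axis (c 1) 1, 0), (0, 1 + t)] \<longleftrightarrow> 1 \<le> x $ c 1 \<and> x $ c 1 \<le> 1 + t"
    "x \<in> ?S [(0, 1), (axis (c i) 1, 0), (axis (c (i - 1)) (1 + t), 0)] \<longleftrightarrow>
      1 \<le> x $ c i \<and> x $ c i \<le> (1 + t) * x $ c (i - 1)" for x i
    by (auto simp: inner_axis')
  then have "cayley_polytope c t = ?S [(0, 1), (axis (c 1) 1, 0), (0, 1 + t)] \<inter>
      \<Inter>((\<lambda>i. ?S [(0, 1), (axis (c i) 1, 0), (axis (c (i - 1)) (1 + t), 0)]) ` {2..CARD('n)})"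
    unfolding set_eq_iff Int_iff INT_iff cayley_polytope_def mem_Collect_eq by blast
  moreover have "polyhedron (?S fs)" for fs
    by (rule polyhedron_sorted)
  ultimately show ?thesis
    by (auto intro!: polyhedron_Int polyhedron_Inter simp del: list.map sorted_simps)
qed

theorem theorem6p2:
  fixes n :: nat and t :: real and c :: "nat \<Rightarrow> 'n::finite"
  assumes "1 \<le> n" and "n = CARD('n)" and "bij_betw c {1..n} UNIV" and "0 < t"
  shows "(\<forall>T\<in>plane_trees (n + 1).
            polytope (tree_polytope c t T) \<and> bounded (tree_polytope c t T) \<and>
            fact n * measure lebesgue (tree_polytope c t T)
              = (\<Sum>G | G \<in> labeled_graphs (n + 1) \<and> Psi (n + 1) G = [T]. t ^ card G) \<and>
            (\<Sum>G | G \<in> labeled_graphs (n + 1) \<and> Psi (n + 1) G = [T]. t ^ card G)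
              = t ^ n
                * (1 + t) powi (int ((n + 1) choose 2)
                                - (\<Sum>i = 1..n + 1. int i * int (degree_seq T ! (i - 1))))
                * (fact n / (\<Prod>i = 1..n + 1. fact (degree_seq T ! (i - 1)))))
       \<and> inj_on (tree_polytope c t) (plane_trees (n + 1))
       \<and> is_subdivision (tree_polytope c t ` plane_trees (n + 1)) (cayley_polytope c t)
       \<and> fact n * measure lebesgue (cayley_polytope c t)
           = (\<Sum>G | G \<in> labeled_graphs (n + 1) \<and> graph_connected (n + 1) G. t ^ card G)"
proof (intro conjI ballI)
  note n = assms(2) and c = assms(3) and t = assms(4)
  let ?D = "tree_polytope c t" and ?\<T> = "plane_trees (n + 1)"
  let ?w = "\<lambda>T. \<Sum>G | G \<in> labeled_graphs (n + 1) \<and> Psi (n + 1) G = [T]. t ^ card G"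
  have "0 < (prod_list (map fact ds) :: real)" for ds :: "nat list"
    by (induction ds) auto
  then have d: "0 < (prod_list (map fact (degree_seq T)) :: real)" for T .
  show poly: "polytope (?D T)" if "T \<in> ?\<T>" for T
    using polytope_tree_polytope[OF that c t n] .
  then show "bounded (?D T)" if "T \<in> ?\<T>" for T
    using that polytope_imp_bounded by blast
  show vol: "fact n * measure lebesgue (?D T) = ?w T" if "T \<in> ?\<T>" for T
  proof -
    \<comment> \<open>Volume and graph sum were both computed times the same positive product of
      degree factorials, which cancels.\<close>
    have "(fact n * measure lebesgue (?D T)) * prod_list (map fact (degree_seq T))
        = ?w T * prod_list (map fact (degree_seq T))"
      using measure_tree_polytope[OF that c t n] sum_graphs_Psi[OF that, of t]
      by (simp add: mult.assoc mult.commute)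
    then show ?thesis
      using d[of T] by simp
  qed
  show "?w T = t ^ n
      * (1 + t) powi (int ((n + 1) choose 2) - (\<Sum>i = 1..n + 1. int i * int (degree_seq T ! (i - 1))))
      * (fact n / (\<Prod>i = 1..n + 1. fact (degree_seq T ! (i - 1))))" if T: "T \<in> ?\<T>" for T
  proof -
    have nodes: "num_nodes [T] = n + 1"
      using T by (simp only: mem_plane_trees_iff)
    have len: "length (degree_seq T) = n + 1"
      using T by (simp add: degree_seq_def plane_trees_def)
    have "(\<Sum>i = 1..n + 1. int i * int (degree_seq T ! (i - 1)))
        = (\<Sum>i<n + 1. (int i + 1) * int (degree_seq T ! i))"
      by (rule sum.reindex_bij_witness[of _ Suc "\<lambda>i. i - 1"]) auto
    then have "int ((n + 1) choose 2) - (\<Sum>i = 1..n + 1. int i * int (degree_seq T ! (i - 1)))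
        = int (stack_weight [T])"
      using stack_weight_eq[of "[T]"] unfolding nodes by simp
    moreover have "(\<Prod>i = 1..n + 1. fact (degree_seq T ! (i - 1)))
        = (\<Prod>i<n + 1. fact (degree_seq T ! i) :: real)"
      by (rule prod.reindex_bij_witness[of _ Suc "\<lambda>i. i - 1"]) auto
    then have "(\<Prod>i = 1..n + 1. fact (degree_seq T ! (i - 1))) = (prod_list (map fact (degree_seq T)) :: real)"
      using len by (simp add: prod.list_conv_set_nth atLeast0LessThan del: prod.lessThan_Suc prod.cl_ivl_Suc)
    ultimately show ?thesis
      using sum_graphs_Psi[OF T, of t] d[of T] by (simp add: field_simps)
  qed
  have negl: "negligible (?D T \<inter> ?D U)" if "T \<in> ?\<T>" "U \<in> ?\<T>" "T \<noteq> U" for T U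
    using negligible_tree_polytope_Int[OF that t] .
  have vol_pos: "0 < measure lebesgue (?D T)" if "T \<in> ?\<T>" for T
  proof -
    have "0 < measure lebesgue (?D T) * prod_list (map fact (degree_seq T))"
      using t unfolding measure_tree_polytope[OF that c t n] by simp
    then show ?thesis
      using d[of T] zero_less_mult_pos2 by blast
  qed
  then have not_negl: "\<not> negligible (?D T)" if "T \<in> ?\<T>" for T
    using that negligible_imp_measure0 by force
  \<comment> \<open>Distinct trees with the same polytope would make that polytope its own
    negligible overlap, against its positive volume.\<close>
  show "inj_on ?D ?\<T>"
  proof (rule inj_onI, rule ccontr)
    fix T U assume "T \<in> ?\<T>" "U \<in> ?\<T>" "?D T = ?D U" "T \<noteq> U"
    then show False using negl[of T U] not_negl[of T] by simp
  qed
  have fin: "finite ?\<T>" by (rule finite_plane_trees)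
  have union: "\<Union>(?D ` ?\<T>) = cayley_polytope c t"
    using Union_tree_polytope[OF n t] .
  show "is_subdivision (?D ` ?\<T>) (cayley_polytope c t)"
    unfolding is_subdivision_def
  proof (intro conjI ballI)
    \<comment> \<open>Boundedness is inherited from the finitely many tree polytopes.\<close>
    have "bounded (cayley_polytope c t)"
      unfolding union[symmetric] using fin poly polytope_imp_bounded by blast
    then show "polytope (cayley_polytope c t)"
      using polyhedron_cayley_polytope polytope_eq_bounded_polyhedron by blast
    show "finite (?D ` ?\<T>)" using fin by simp
    show "\<Union>(?D ` ?\<T>) = cayley_polytope c t" by (rule union)
    fix D assume "D \<in> ?D ` ?\<T>"
    then obtain T where T: "T \<in> ?\<T>" "D = ?D T" by blast
    show "polytope D" using poly T by simp
    \<comment> \<open>A convex set with empty interior is negligible, so positive volume gives full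
      dimension.\<close>
    have "interior D \<noteq> {}"
      using not_negl[OF T(1)] poly[OF T(1)] T(2) negligible_convex_interior polytope_imp_convex by blast
    then show "aff_dim D = int DIM(real^'n)"
      by (rule aff_dim_nonempty_interior)
  next
    show "pairwise (\<lambda>A B. interior A \<inter> interior B = {}) (?D ` ?\<T>)"
    proof (rule pairwiseI)
      fix A B assume "A \<in> ?D ` ?\<T>" "B \<in> ?D ` ?\<T>" "A \<noteq> B"
      then have "negligible (A \<inter> B)"
        using negl by blast
      then have "negligible (interior A \<inter> interior B)"
        by (rule negligible_subset) (use interior_subset in blast)
      then show "interior A \<inter> interior B = {}"
        using open_not_negligible[of "interior A \<inter> interior B"] by auto
    qed
  qed
  have "measure lebesgue (cayley_polytope c t) = (\<Sum>T\<in>?\<T>. measure lebesgue (?D T))"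
    unfolding union[symmetric]
  proof (rule measure_negligible_finite_Union_image[OF fin])
    show "?D T \<in> lmeasurable" if "T \<in> ?\<T>" for T
      using poly[OF that] by (intro lmeasurable_compact polytope_imp_compact)
    show "pairwise (\<lambda>T U. negligible (?D T \<inter> ?D U)) ?\<T>"
      using negl by (rule pairwiseI)
  qed
  then have "fact n * measure lebesgue (cayley_polytope c t) = (\<Sum>T\<in>?\<T>. fact n * measure lebesgue (?D T))"
    by (simp only: sum_distrib_left)
  also have "\<dots> = (\<Sum>T\<in>?\<T>. ?w T)"
    by (intro sum.cong refl vol)
  \<comment> \<open>The fibres of \<open>Psi\<close> over the one-tree forests are disjoint, and
    together they are the connected graphs.\<close>
  also have "\<dots> = (\<Sum>G\<in>(\<Union>T\<in>?\<T>. {G. G \<in> labeled_graphs (n + 1) \<and> Psi (n + 1) G = [T]}). t ^ card G)"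
  proof (rule sum.UNION_disjoint[symmetric])
    show "finite ?\<T>" by (rule fin)
    have "finite (labeled_graphs (n + 1))"
      using finite_graphs_on[of "{1..n + 1}"] by (simp add: labeled_graphs_def graphs_on_def)
    then show "\<forall>T\<in>?\<T>. finite {G. G \<in> labeled_graphs (n + 1) \<and> Psi (n + 1) G = [T]}"
      by simp
  qed auto
  also have "(\<Union>T\<in>?\<T>. {G. G \<in> labeled_graphs (n + 1) \<and> Psi (n + 1) G = [T]})
      = {G. G \<in> labeled_graphs (n + 1) \<and> graph_connected (n + 1) G}"
  proof (intro set_eqI iffI)
    fix G assume "G \<in> {G. G \<in> labeled_graphs (n + 1) \<and> graph_connected (n + 1) G}"
    then show "G \<in> (\<Union>T\<in>?\<T>. {G. G \<in> labeled_graphs (n + 1) \<and> Psi (n + 1) G = [T]})"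
      using ex_Psi_connected[of G "n + 1"] by auto
  next
    fix G assume "G \<in> (\<Union>T\<in>?\<T>. {G. G \<in> labeled_graphs (n + 1) \<and> Psi (n + 1) G = [T]})"
    then show "G \<in> {G. G \<in> labeled_graphs (n + 1) \<and> graph_connected (n + 1) G}"
      using not_connected_Psi[of G "n + 1"] by auto
  qed
  finally show "fact n * measure lebesgue (cayley_polytope c t)
      = (\<Sum>G | G \<in> labeled_graphs (n + 1) \<and> graph_connected (n + 1) G. t ^ card G)" .
qed

end
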